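(* Let $g\in L_q^2(\mathbb{R}_{q,+},x^{2\alpha+1}d_qx)$ be a $q$-wavelet associated with the $q$-Bessel operator. (i) (Plancherel formula) For every $f\in L_q^2(\mathbb{R}_{q,+},x^{2\alpha+1}d_qx)$, $$\frac{1}{C_g}\int_0^\infty\int_0^\infty\left|\Psi^{\alpha}_{q,g}(f)(a,b)\right|^2 b^{2\alpha+1}\frac{d_qb\,d_qa}{a^2}=\|f\|_{2,\alpha,q}^2 .$$ (ii) (Parseval formula) For all $f_1,f_2\in L_q^2(\mathbb{R}_{q,+},x^{2\alpha+1}d_qx)$, $$\int_0^\infty f_1(x)\overline{f_2(x)}\,x^{2\alpha+1}d_qx=\frac{1}{C_g}\int_0^\infty\int_0^\infty\Psi^{\alpha}_{q,g}(f_1)(a,b)\,\overline{\Psi^{\alpha}_{q,g}(f_2)(a,b)}\,b^{2\alpha+1}\frac{d_qa\,d_qb}{a^2}.$$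
   Context: Fix $q\in\,]0,1[$ with $\frac{\log(1-q)}{\log q}\in\mathbb{Z}$ and $\alpha>-\frac12$. Functions are complex valued. $(a;q)_0=1$, $(a;q)_n=\prod_{k=0}^{n-1}(1-aq^k)$, $(a;q)_\infty=\prod_{k\ge0}(1-aq^k)$; $\Gamma_q(x)=\frac{(q;q)_\infty}{(q^x;q)_\infty}(1-q)^{1-x}$, and $\Gamma_{q^2}$ is the same with $q$ replaced by $q^2$. $\mathbb{R}_{q,+}=\{q^n:n\in\mathbb{Z}\}$, $\widetilde{\mathbb{R}}_{q,+}=\mathbb{R}_{q,+}\cup\{0\}$. Jackson integral: $\int_0^\infty f(x)\,d_qx=(1-q)\sum_{n\in\mathbb{Z}}f(q^n)q^n$. $L_q^2(\mathbb{R}_{q,+},x^{2\alpha+1}d_qx)$ is the space of functions on $\mathbb{R}_{q,+}$ with $\|f\|_{2,\alpha,q}=\left(\int_0^\infty|f(x)|^2x^{2\alpha+1}d_qx\right)^{1/2}<\infty$ (its elements are regarded as even functions). Normalized $q$-Bessel function: $j_\alpha^{(3)}(z;q^2)=\sum_{n\ge0}\frac{(-1)^nq^{n(n-1)}(1-q)^{2n}z^{2n}}{(q^2;q^2)_n(q^{2\alpha+2};q^2)_n}$. $q$-Bessel Fourier transform: $\mathcal{F}_{\alpha,q}(f)(\lambda)=c_{\alpha,q}\int_0^\infty f(x)j_\alpha^{(3)}(\lambda x;q^2)x^{2\alpha+1}d_qx$ with $c_{\alpha,q}=\frac{(1+q^{-1})^{-\alpha}}{\Gamma_{q^2}(\alpha+1)}$;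 it is an isomorphism of $L_q^2(\mathbb{R}_{q,+},x^{2\alpha+1}d_qx)$ with $\mathcal{F}_{\alpha,q}^{-1}=q^{-4\alpha-2}\mathcal{F}_{\alpha,q}$. For $x\in\widetilde{\mathbb{R}}_{q,+}$ the $q$-Bessel translation $T_{q,x}^\alpha$ acts on $L_q^2(\mathbb{R}_{q,+},x^{2\alpha+1}d_qx)$ by $\mathcal{F}_{\alpha,q}(T_{q,x}^\alpha f)(\lambda)=j_\alpha^{(3)}(\lambda x;q^2)\mathcal{F}_{\alpha,q}(f)(\lambda)$, $\lambda\in\mathbb{R}_{q,+}$. A $q$-wavelet associated with the $q$-Bessel operator is an even $g\in L_q^2(\mathbb{R}_{q,+},x^{2\alpha+1}d_qx)$ with $0<C_g=\int_0^\infty|\mathcal{F}_{\alpha,q}(g)(a)|^2\frac{d_qa}{a}<\infty$. For $a\in\mathbb{R}_{q,+}$, $b\in\widetilde{\mathbb{R}}_{q,+}$: $g_a(x)=a^{-2\alpha-2}g(x/a)$ and $g_{a,b}=\sqrt a\,T_{q,b}^\alpha(g_a)$. The continuous $q$-wavelet transform associated with the $q$-Bessel operator is $\Psi^{\alpha}_{q,g}(f)(a,b)=c_{\alpha,q}\int_0^\infty f(x)\overline{g_{a,b}(x)}\,x^{2\alpha+1}d_qx$. *)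

theory Defs
  imports "HOL-Analysis.Analysis"
begin

definition q_pochhammer :: "real \<Rightarrow> real \<Rightarrow> nat \<Rightarrow> real" where
  "q_pochhammer a q n = (\<Prod>k<n. 1 - a * q ^ k)"

definition q_pochhammer_inf :: "real \<Rightarrow> real \<Rightarrow> real" where
  "q_pochhammer_inf a q = (\<Prod>k. 1 - a * q ^ k)"

definition q_Gamma :: "real \<Rightarrow> real \<Rightarrow> real" where
  "q_Gamma q x =
     q_pochhammer_inf q q / q_pochhammer_inf (q powr x) q * (1 - q) powr (1 - x)"

definition q_lattice :: "real \<Rightarrow> real set" where
  "q_lattice q = range (\<lambda>n::int. q powi n)"

(* Jackson integral over ]0,\<infinity>[.  infsum is 0 on divergent families, so convergence is tracked
   separately by q_integrable; for real and complex values it amounts to absolute convergence. *)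
definition q_integrable :: "real \<Rightarrow> (real \<Rightarrow> 'a::real_normed_vector) \<Rightarrow> bool" where
  "q_integrable q f \<longleftrightarrow> (\<lambda>n::int. q powi n *\<^sub>R f (q powi n)) summable_on UNIV"

definition q_integral :: "real \<Rightarrow> (real \<Rightarrow> 'a::real_normed_vector) \<Rightarrow> 'a" where
  "q_integral q f = (1 - q) *\<^sub>R (\<Sum>\<^sub>\<infinity>n::int. q powi n *\<^sub>R f (q powi n))"

(* Convergence of the double series behind an iterated Jackson integral.  For real and complex
   values it is absolute, so it gives convergence of the iterated integrals in either order. *)
definition q_integrable2 :: "real \<Rightarrow> (real \<Rightarrow> real \<Rightarrow> 'a::real_normed_vector) \<Rightarrow> bool" where
  "q_integrable2 q h \<longleftrightarrow>
     (\<lambda>(m::int, n::int). (q powi m * q powi n) *\<^sub>R h (q powi m) (q powi n)) summable_on UNIV"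

(* Functions on q_lattice q are modelled by total functions; values off the lattice are
   irrelevant. *)
definition q_L2 :: "real \<Rightarrow> real \<Rightarrow> (real \<Rightarrow> complex) set" where
  "q_L2 q \<alpha> = {f. q_integrable q (\<lambda>x. (cmod (f x))\<^sup>2 * x powr (2 * \<alpha> + 1))}"

definition q_L2_norm :: "real \<Rightarrow> real \<Rightarrow> (real \<Rightarrow> complex) \<Rightarrow> real" where
  "q_L2_norm q \<alpha> f = sqrt (q_integral q (\<lambda>x. (cmod (f x))\<^sup>2 * x powr (2 * \<alpha> + 1)))"

(* The normalized third Jackson q-Bessel function with base q^2. *)
definition q_bessel_j3 :: "real \<Rightarrow> real \<Rightarrow> complex \<Rightarrow> complex" where
  "q_bessel_j3 q \<alpha> z =
     (\<Sum>n. of_real ((-1) ^ n * q ^ (n * (n - 1)) * (1 - q) ^ (2 * n)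
              / (q_pochhammer (q\<^sup>2) (q\<^sup>2) n * q_pochhammer (q powr (2 * \<alpha> + 2)) (q\<^sup>2) n))
            * z ^ (2 * n))"

definition q_bessel_const :: "real \<Rightarrow> real \<Rightarrow> real" where
  "q_bessel_const q \<alpha> = (1 + inverse q) powr (- \<alpha>) / q_Gamma (q\<^sup>2) (\<alpha> + 1)"

definition q_fourier :: "real \<Rightarrow> real \<Rightarrow> (real \<Rightarrow> complex) \<Rightarrow> real \<Rightarrow> complex" where
  "q_fourier q \<alpha> f y =
     of_real (q_bessel_const q \<alpha>) *
     q_integral q (\<lambda>x. f x * q_bessel_j3 q \<alpha> (of_real (y * x)) * of_real (x powr (2 * \<alpha> + 1)))"

(* The translate is determined on the lattice by its transform; its even extension by 0 is the
   chosen representative, so that the description is unique. *)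
definition q_translation ::
    "real \<Rightarrow> real \<Rightarrow> real \<Rightarrow> (real \<Rightarrow> complex) \<Rightarrow> real \<Rightarrow> complex" where
  "q_translation q \<alpha> x f =
     (THE h. h \<in> q_L2 q \<alpha> \<and> (\<forall>y. h (- y) = h y) \<and> (\<forall>y. \<bar>y\<bar> \<notin> q_lattice q \<longrightarrow> h y = 0) \<and>
        (\<forall>t\<in>q_lattice q.
           q_fourier q \<alpha> h t = q_bessel_j3 q \<alpha> (of_real (t * x)) * q_fourier q \<alpha> f t))"

definition wavelet_const :: "real \<Rightarrow> real \<Rightarrow> (real \<Rightarrow> complex) \<Rightarrow> real" where
  "wavelet_const q \<alpha> g = q_integral q (\<lambda>a. (cmod (q_fourier q \<alpha> g a))\<^sup>2 / a)"

definition q_wavelet :: "real \<Rightarrow> real \<Rightarrow> (real \<Rightarrow> complex) \<Rightarrow> bool" where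
  "q_wavelet q \<alpha> g \<longleftrightarrow>
     g \<in> q_L2 q \<alpha> \<and> (\<forall>x\<in>q_lattice q. g (- x) = g x) \<and>
     q_integrable q (\<lambda>a. (cmod (q_fourier q \<alpha> g a))\<^sup>2 / a) \<and> 0 < wavelet_const q \<alpha> g"

definition q_dilation :: "real \<Rightarrow> real \<Rightarrow> (real \<Rightarrow> complex) \<Rightarrow> real \<Rightarrow> complex" where
  "q_dilation \<alpha> a g x = of_real (a powr (- 2 * \<alpha> - 2)) * g (x / a)"

definition wavelet_atom ::
    "real \<Rightarrow> real \<Rightarrow> (real \<Rightarrow> complex) \<Rightarrow> real \<Rightarrow> real \<Rightarrow> real \<Rightarrow> complex" where
  "wavelet_atom q \<alpha> g a b x = of_real (sqrt a) * q_translation q \<alpha> b (q_dilation \<alpha> a g) x"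

definition wavelet_transform ::
    "real \<Rightarrow> real \<Rightarrow> (real \<Rightarrow> complex) \<Rightarrow> (real \<Rightarrow> complex) \<Rightarrow> real \<Rightarrow> real \<Rightarrow> complex" where
  "wavelet_transform q \<alpha> g f a b =
     of_real (q_bessel_const q \<alpha>) *
     q_integral q (\<lambda>x. f x * cnj (wavelet_atom q \<alpha> g a b x) * of_real (x powr (2 * \<alpha> + 1)))"

end

theory Submission
  imports Defs
begin

text \<open>Write \<open>p = q\<^sup>2\<close> and \<open>v = q powr (\<alpha> + 1)\<close>. Sampling a function \<open>f\<close> on the lattice and
weighting it, \<open>x n = f (q powi n) * v powi n\<close>, turns the weighted Jackson \<open>L\<^sup>2\<close> space into
\<open>\<ell>\<^sup>2(\<int>)\<close>. Since the \<open>q\<close>-Bessel kernel depends on the product of its two variables only, the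
Fourier transform becomes a Hankel operator \<open>x \<mapsto> (\<lambda>n. \<Sum>m. h (n + m) * x m)\<close>, up to the factor \<open>\<kappa> =
q powr (2 * \<alpha> + 1)\<close>. The hypothesis that \<open>ln (1 - q) / ln q\<close> is an integer \<open>s\<close> says that the
factor \<open>1 - q\<close> in the argument of the Bessel function is the lattice point \<open>q powi s\<close>, so that all
values of the Bessel function that occur are values on one lattice.

The analytic core is the orthogonality relation of the Hahn-Exton \<open>q\<close>-Bessel functions,
\<open>bessel_seq_orthogonal\<close>, which makes the rows of the Hankel matrix orthonormal
(\<open>bessel_kernel_orthonormal\<close>). Up to a constant, the lattice values of the Bessel function are the
Laurent coefficients \<open>u k\<close> of \<open>G t = (w/t; p)\<^sub>\<infinity> / (t; p)\<^sub>\<infinity>\<close> with \<open>w = v\<^sup>2\<close> (\<open>bessel_seq_series\<close>),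
and \<open>G t * G (w/t) = 1\<close>; comparing coefficients gives \<open>\<Sum>b. w powi b * u (b + d) * u b = (if d = 0
then 1 else 0)\<close>.

A symmetric matrix with orthonormal rows is a unitary involution: Bessel's inequality makes it a
contraction, hence it is self-adjoint on \<open>\<ell>\<^sup>2\<close>, and its square is the identity
(\<open>hankel_self_adjoint\<close>, \<open>hankel_involution\<close>). This is the inversion and the Plancherel formula for
the \<open>q\<close>-Bessel Fourier transform, and it shows that the translates are well defined
(\<open>translation_coeffs\<close>).

Finally, with \<open>\<gamma> i\<close> the Fourier transform of \<open>g\<close> at \<open>q powi i\<close>, the wavelet transform at scale \<open>q
powi j\<close> is, up to weights, the Hankel transform of \<open>\<lambda>t. hankel x t * cnj (\<gamma> (j + t))\<close>
(\<open>wavelet_transform_lattice\<close>). So the sum over all positions \<open>b\<close> is evaluated by unitarity, and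
the sum over all scales meets \<open>\<Sum>j. (cmod (\<gamma> (j + t)))\<^sup>2\<close>, which does not depend on \<open>t\<close> and is the
wavelet constant up to the factor \<open>1 - q\<close> (\<open>band_has_sum\<close>).\<close>

section \<open>Infinite q-Pochhammer products and Euler's expansions\<close>

lemma q_pochhammer_Suc: "q_pochhammer a p (Suc n) = q_pochhammer a p n * (1 - a * p ^ n)"
  by (simp add: q_pochhammer_def)

lemma q_pochhammer_pos:
  assumes "0 \<le> a" "a < 1" "0 < p" "p < 1"
  shows "0 < q_pochhammer a p n"
  unfolding q_pochhammer_def
proof (rule prod_pos)
  fix k
  have "a * p ^ k \<le> a * 1"
    using assms by (intro mult_left_mono) (auto simp: power_le_one)
  then show "0 < 1 - a * p ^ k"
    using assms by simp
qed

lemma convergent_prod_q_pochhammer: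
  fixes x p :: real
  assumes "0 < p" "p < 1"
  shows "convergent_prod (\<lambda>k. 1 - x * p ^ k)"
proof -
  have "summable (\<lambda>k. norm ((1 - x * p ^ k) - 1))"
    using assms by (auto simp: abs_mult power_abs intro!: summable_mult summable_geometric)
  then show ?thesis
    by (intro abs_convergent_prod_imp_convergent_prod summable_imp_abs_convergent_prod)
qed

lemma q_pochhammer_tendsto_inf:
  assumes "0 < p" "p < 1"
  shows "(\<lambda>n. q_pochhammer x p n) \<longlonglongrightarrow> q_pochhammer_inf x p"
proof -
  have "(\<lambda>n. q_pochhammer x p (Suc n)) \<longlonglongrightarrow> q_pochhammer_inf x p"
    using convergent_prod_LIMSEQ[OF convergent_prod_q_pochhammer[OF assms, of x]]
    by (simp add: q_pochhammer_def q_pochhammer_inf_def lessThan_Suc_atMost)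
  then show ?thesis
    by (rule LIMSEQ_imp_Suc)
qed

lemma q_pochhammer_inf_rec:
  assumes "0 < p" "p < 1"
  shows "q_pochhammer_inf x p = (1 - x) * q_pochhammer_inf (x * p) p"
proof -
  have "q_pochhammer x p (Suc n) = (1 - x) * q_pochhammer (x * p) p n" for n
    by (simp add: q_pochhammer_def prod.lessThan_Suc_shift algebra_simps del: prod.lessThan_Suc)
  moreover have "(\<lambda>n. (1 - x) * q_pochhammer (x * p) p n) \<longlonglongrightarrow> (1 - x) * q_pochhammer_inf (x * p) p"
    by (intro tendsto_intros q_pochhammer_tendsto_inf assms)
  moreover have "(\<lambda>n. q_pochhammer x p (Suc n)) \<longlonglongrightarrow> q_pochhammer_inf x p"
    by (rule LIMSEQ_Suc[OF q_pochhammer_tendsto_inf[OF assms]])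
  ultimately show ?thesis
    using LIMSEQ_unique by auto
qed

lemma q_pochhammer_inf_split:
  assumes "0 < p" "p < 1"
  shows "q_pochhammer_inf x p = q_pochhammer x p n * q_pochhammer_inf (x * p ^ n) p"
proof (induction n)
  case 0
  show ?case by (simp add: q_pochhammer_def)
next
  case (Suc n)
  have "q_pochhammer_inf (x * p ^ n) p = (1 - x * p ^ n) * q_pochhammer_inf (x * p ^ Suc n) p"
    using q_pochhammer_inf_rec[OF assms, of "x * p ^ n"] by (simp add: mult_ac)
  then show ?case
    using Suc by (simp add: q_pochhammer_Suc)
qed

lemma q_pochhammer_inf_pos:
  assumes "0 \<le> x" "x < 1" "0 < p" "p < 1"
  shows "0 < q_pochhammer_inf x p"
proof -
  have "q_pochhammer_inf x p \<noteq> 0"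
    unfolding q_pochhammer_inf_def
  proof (rule prodinf_nonzero[OF convergent_prod_q_pochhammer[OF assms(3,4)]])
    fix k
    have "x * p ^ k \<le> x * 1"
      using assms by (intro mult_left_mono) (auto simp: power_le_one)
    then show "1 - x * p ^ k \<noteq> 0"
      using assms by simp
  qed
  moreover have "0 \<le> q_pochhammer_inf x p"
    by (rule LIMSEQ_le_const[OF q_pochhammer_tendsto_inf[OF assms(3,4)]])
       (use q_pochhammer_pos[OF assms] less_imp_le in blast)
  ultimately show ?thesis by simp
qed

lemma q_pochhammer_inf_le_1:
  assumes "0 \<le> x" "x \<le> 1" "0 < p" "p < 1"
  shows "q_pochhammer_inf x p \<le> 1"
proof (rule LIMSEQ_le_const2[OF q_pochhammer_tendsto_inf[OF assms(3,4)]])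
  have "q_pochhammer x p n \<le> 1" for n
    unfolding q_pochhammer_def
  proof (rule prod_le_1)
    fix k
    have "x * p ^ k \<le> 1 * 1"
      using assms by (intro mult_mono) (auto simp: power_le_one)
    then show "0 \<le> 1 - x * p ^ k \<and> 1 - x * p ^ k \<le> 1"
      using assms by simp
  qed
  then show "\<exists>N. \<forall>n\<ge>N. q_pochhammer x p n \<le> 1"
    by blast
qed

text \<open>The power series coefficients of \<open>(x; p)\<^sub>\<infinity>\<close>, see \<open>euler_has_sum\<close>.\<close>
definition euler_coeff :: "real \<Rightarrow> nat \<Rightarrow> real" where
  "euler_coeff p n = (-1) ^ n * p ^ (n choose 2) / q_pochhammer p p n"

lemma euler_coeff_Suc:
  "euler_coeff p (Suc n) = - (p ^ n / (1 - p ^ Suc n)) * euler_coeff p n"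
  by (simp add: euler_coeff_def q_pochhammer_Suc power_add numeral_2_eq_2 field_simps)

lemma euler_coeff_summable:
  assumes "0 < p" "p < 1"
  shows "summable (\<lambda>n. norm (euler_coeff p n * x ^ n))"
proof -
  have "(\<lambda>n. p ^ n / (1 - p ^ Suc n) * \<bar>x\<bar>) \<longlonglongrightarrow> 0 / (1 - 0) * \<bar>x\<bar>"
    using assms by (intro tendsto_intros LIMSEQ_Suc[OF LIMSEQ_power_zero] LIMSEQ_power_zero) auto
  then have "\<forall>\<^sub>F n in sequentially. p ^ n / (1 - p ^ Suc n) * \<bar>x\<bar> < 1 / 2"
    by (rule order_tendstoD) simp
  then obtain N where N: "\<And>n. n \<ge> N \<Longrightarrow> p ^ n / (1 - p ^ Suc n) * \<bar>x\<bar> < 1 / 2"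
    by (auto simp: eventually_sequentially)
  show ?thesis
  proof (rule summable_ratio_test[of "1/2" N])
    fix n assume "N \<le> n"
    have pos: "0 < 1 - p ^ Suc n"
      using assms power_Suc_less_one[of p n] by simp
    have "norm (norm (euler_coeff p (Suc n) * x ^ Suc n))
          = p ^ n / (1 - p ^ Suc n) * \<bar>x\<bar> * norm (euler_coeff p n * x ^ n)"
      using pos assms by (simp add: euler_coeff_Suc abs_mult power_abs abs_divide)
    also have "\<dots> \<le> 1 / 2 * norm (euler_coeff p n * x ^ n)"
      using N[OF \<open>N \<le> n\<close>] by (intro mult_right_mono) auto
    finally show "norm (norm (euler_coeff p (Suc n) * x ^ Suc n))
                  \<le> 1 / 2 * norm (norm (euler_coeff p n * x ^ n))" by simp
  qed simp
qed

text \<open>Euler's expansion of \<open>(x; p)\<^sub>\<infinity>\<close>. The series and the product satisfy the same functional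
equation \<open>S x = (1 - x) * S (x * p)\<close>; iterating it moves the argument to \<open>0\<close>, where the series is
continuous with value \<open>1\<close>.\<close>
lemma euler_has_sum:
  assumes p: "0 < p" "p < 1"
  shows "((\<lambda>n. euler_coeff p n * x ^ n) has_sum q_pochhammer_inf x p) UNIV"
proof -
  define S where "S x = (\<Sum>n. euler_coeff p n * x ^ n)" for x
  have sm: "summable (\<lambda>n. euler_coeff p n * x ^ n)" for x
    by (rule summable_norm_cancel[OF euler_coeff_summable[OF p]])
  have rec: "S x = (1 - x) * S (x * p)" for x
  proof -
    have coeff: "euler_coeff p (Suc n) * x ^ Suc n - euler_coeff p (Suc n) * (x * p) ^ Suc n
          = - x * (euler_coeff p n * (x * p) ^ n)" for n
    proof -
      have "1 - p ^ Suc n \<noteq> 0"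
        using p power_Suc_less_one[of p n] by simp
      then have "euler_coeff p (Suc n) * (1 - p ^ Suc n) = - (p ^ n * euler_coeff p n)"
        by (simp add: euler_coeff_Suc)
      then have "euler_coeff p (Suc n) * (1 - p ^ Suc n) * x ^ Suc n
                 = - (p ^ n * euler_coeff p n) * x ^ Suc n" by (rule arg_cong)
      then show ?thesis
        by (simp add: algebra_simps power_mult_distrib)
    qed
    have "S x - S (x * p) = (\<Sum>n. euler_coeff p n * x ^ n - euler_coeff p n * (x * p) ^ n)"
      unfolding S_def by (rule suminf_diff[OF sm sm])
    also have "\<dots> = (\<Sum>n. euler_coeff p (Suc n) * x ^ Suc n - euler_coeff p (Suc n) * (x * p) ^ Suc n)"
      using suminf_split_head[OF summable_diff[OF sm[of x] sm[of "x * p"]]] by simp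
    also have "\<dots> = - x * S (x * p)"
      unfolding coeff S_def by (rule suminf_mult[OF sm])
    finally show ?thesis by (simp add: algebra_simps)
  qed
  have split: "S x = q_pochhammer x p n * S (x * p ^ n)" for n
  proof (induction n)
    case 0
    show ?case by (simp add: q_pochhammer_def)
  next
    case (Suc n)
    then show ?case
      using rec[of "x * p ^ n"] by (simp add: q_pochhammer_Suc mult_ac)
  qed
  have "isCont S 0"
    unfolding S_def using isCont_powser[of "euler_coeff p" 1 0] sm[of 1] by simp
  moreover have "(\<lambda>n. x * p ^ n) \<longlonglongrightarrow> x * 0"
    using p by (intro tendsto_intros LIMSEQ_power_zero) auto
  ultimately have "(\<lambda>n. S (x * p ^ n)) \<longlonglongrightarrow> S 0"
    by (intro isCont_tendsto_compose[of 0 S]) simp_all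
  moreover have "S 0 = 1"
    unfolding S_def powser_zero by (simp add: euler_coeff_def q_pochhammer_def numeral_2_eq_2)
  ultimately have "(\<lambda>n. q_pochhammer x p n * S (x * p ^ n)) \<longlonglongrightarrow> q_pochhammer_inf x p * 1"
    using p by (intro tendsto_mult q_pochhammer_tendsto_inf) auto
  then have "(\<lambda>n. S x) \<longlonglongrightarrow> q_pochhammer_inf x p"
    using split by simp
  then have "S x = q_pochhammer_inf x p"
    using LIMSEQ_const_iff by blast
  then have "(\<lambda>n. euler_coeff p n * x ^ n) sums q_pochhammer_inf x p"
    using summable_sums[OF sm[of x]] by (simp add: S_def)
  then show ?thesis
    by (rule norm_summable_imp_has_sum[OF euler_coeff_summable[OF p]])
qed

text \<open>Sequences on the natural numbers are extended by \<open>0\<close> to the integers from here on, since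
then shifts and changes of variables need no side conditions.\<close>
lemma has_sum_int_nat:
  fixes f :: "nat \<Rightarrow> 'a::{comm_monoid_add,topological_space}"
  shows "((\<lambda>i::int. if i < 0 then 0 else f (nat i)) has_sum S) UNIV \<longleftrightarrow> (f has_sum S) UNIV"
proof -
  have "bij_betw int UNIV {0..}"
    by (rule bij_betw_byWitness[of _ nat]) auto
  then have "(f has_sum S) UNIV \<longleftrightarrow> ((\<lambda>i::int. f (nat i)) has_sum S) {0..}"
    using has_sum_reindex_bij_betw[of int UNIV "{0..}" "\<lambda>i. f (nat i)" S] by simp
  also have "\<dots> \<longleftrightarrow> ((\<lambda>i::int. if i < 0 then 0 else f (nat i)) has_sum S) UNIV"
    by (rule has_sum_cong_neutral) auto
  finally show ?thesis by simp
qed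

definition euler_int :: "real \<Rightarrow> int \<Rightarrow> real" where
  "euler_int p i = (if i < 0 then 0 else euler_coeff p (nat i))"

text \<open>The power series coefficients of \<open>1 / (x; p)\<^sub>\<infinity>\<close>, see \<open>euler_recip_convolution\<close>.\<close>
definition recip_int :: "real \<Rightarrow> int \<Rightarrow> real" where
  "recip_int p i = (if i < 0 then 0 else 1 / q_pochhammer p p (nat i))"

lemma euler_int_has_sum:
  assumes p: "0 < p" "p < 1"
  shows "((\<lambda>i. euler_int p i * x powi i) has_sum q_pochhammer_inf x p) UNIV"
proof -
  have eq: "(\<lambda>i. euler_int p i * x powi i)
      = (\<lambda>i. if i < 0 then 0 else euler_coeff p (nat i) * x ^ nat i)"
    by (auto simp: euler_int_def power_int_def)
  show ?thesis
    unfolding eq by (subst has_sum_int_nat) (rule euler_has_sum[OF p])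
qed

lemma euler_int_abs_summable:
  assumes p: "0 < p" "p < 1"
  shows "(\<lambda>i. \<bar>euler_int p i * x powi i\<bar>) summable_on UNIV"
  using has_sum_imp_summable[OF euler_int_has_sum[OF p, of x]]
  by (subst (asm) summable_on_iff_abs_summable_on_real) simp

lemma euler_int_rec:
  assumes p: "0 < p" "p < 1"
  shows "(1 - p powi i) * euler_int p i = - (p powi (i - 1)) * euler_int p (i - 1)"
proof (cases "i \<le> 0")
  case False
  define n where "n = nat (i - 1)"
  have i: "i = int (Suc n)" using False by (simp add: n_def)
  have "1 - p ^ Suc n \<noteq> 0"
    using p power_Suc_less_one[of p n] by simp
  then have "euler_coeff p (Suc n) * (1 - p ^ Suc n) = - (p ^ n * euler_coeff p n)"
    by (simp add: euler_coeff_Suc)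
  then show ?thesis
    unfolding i by (simp add: euler_int_def nat_add_distrib power_int_def mult_ac del: power_Suc)
qed (auto simp: euler_int_def)

lemma recip_int_rec:
  assumes p: "0 < p" "p < 1"
  shows "(1 - p powi i) * recip_int p i = recip_int p (i - 1)"
proof (cases "i \<le> 0")
  case False
  define n where "n = nat (i - 1)"
  have i: "i = int (Suc n)" using False by (simp add: n_def)
  have "1 - p ^ Suc n \<noteq> 0" "q_pochhammer p p n \<noteq> 0"
    using p power_Suc_less_one[of p n] q_pochhammer_pos[of p p n] by auto
  then show ?thesis
    unfolding i by (simp add: recip_int_def nat_add_distrib power_int_def q_pochhammer_Suc
        field_simps)
qed (auto simp: recip_int_def)

text \<open>At a negative index the right-hand side has the factor \<open>1 - 1\<close> in its numerator, so the
extension by \<open>0\<close> is the one that the product formula dictates.\<close>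
lemma recip_int_eq:
  assumes p: "0 < p" "p < 1"
  shows "recip_int p i = q_pochhammer_inf (p powi (i + 1)) p / q_pochhammer_inf p p"
proof (cases "i < 0")
  case True
  define n where "n = nat (- i - 1)"
  have i: "i + 1 = - int n" using True by (simp add: n_def)
  have z: "p powi (i + 1) * p ^ n = 1"
    unfolding i using p by (simp add: power_int_def power_inverse)
  have "q_pochhammer_inf (p powi (i + 1)) p = 0"
    using q_pochhammer_inf_split[OF p, of "p powi (i+1)" n] q_pochhammer_inf_rec[OF p, of 1] z by simp
  then show ?thesis using True by (simp add: recip_int_def)
next
  case False
  define n where "n = nat i"
  have i: "i = int n" using False by (simp add: n_def)
  have "q_pochhammer_inf p p = q_pochhammer p p n * q_pochhammer_inf (p powi (i + 1)) p"
    unfolding i using q_pochhammer_inf_split[OF p, of p n]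
        by (simp add: power_int_def nat_add_distrib)
  moreover have "q_pochhammer_inf p p > 0" "q_pochhammer p p n > 0"
    using p by (auto intro!: q_pochhammer_inf_pos q_pochhammer_pos)
  ultimately show ?thesis
    by (auto simp: i recip_int_def field_simps)
qed

lemma recip_int_bound:
  assumes p: "0 < p" "p < 1"
  shows "\<bar>recip_int p i\<bar> \<le> 1 / q_pochhammer_inf p p"
proof (cases "i < 0")
  case False
  have *: "0 < q_pochhammer_inf p p"
    using p by (intro q_pochhammer_inf_pos) auto
  have x: "0 < p powi (i + 1)" "p powi (i + 1) \<le> 1" "p powi (i+1) < 1"
    using p False power_Suc_less_one[of p "nat i"] by (auto simp: power_int_def nat_add_distrib)
  have "0 < q_pochhammer_inf (p powi (i + 1)) p" "q_pochhammer_inf (p powi (i + 1)) p \<le> 1"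
    using x p by (auto intro!: q_pochhammer_inf_pos q_pochhammer_inf_le_1)
  then show ?thesis
    unfolding recip_int_eq[OF p] using * by (simp add: divide_right_mono)
next
  case True
  have *: "0 < q_pochhammer_inf p p"
    using p by (intro q_pochhammer_inf_pos) auto
  show ?thesis using True * by (simp add: recip_int_def)
qed

lemma finite_int_support: "(\<And>i. i < (0::int) \<or> n < i \<Longrightarrow> f i = 0) \<Longrightarrow> (f has_sum (\<Sum>i\<in>{0..n}. f i)) UNIV"
  by (rule has_sum_finite_neutralI) auto

text \<open>The Cauchy product of the series of \<open>(x; p)\<^sub>\<infinity>\<close> and of its reciprocal. Splitting \<open>1 - p powi
n\<close> as \<open>p powi i * (1 - p powi (n - i)) + (1 - p powi i)\<close> and applying the recurrences of the two
coefficient sequences makes \<open>(1 - p powi n)\<close> times the convolution sum telescope, so the sum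
vanishes for \<open>n \<noteq> 0\<close>.\<close>
lemma euler_recip_convolution:
  assumes p: "0 < p" "p < 1"
  shows "((\<lambda>i. recip_int p (n - i) * euler_int p i) has_sum (if n = 0 then 1 else 0)) UNIV"
proof -
  define c where "c n = (\<Sum>i\<in>{0..n}. recip_int p (n - i) * euler_int p i)" for n
  have c: "((\<lambda>i. recip_int p (n - i) * euler_int p i) has_sum c n) UNIV" for n
    unfolding c_def by (rule finite_int_support) (auto simp: recip_int_def euler_int_def)
  have c': "((\<lambda>i. p powi i * recip_int p (n - 1 - i) * euler_int p i) has_sum d) UNIV
            \<Longrightarrow> ((\<lambda>i. (1 - p powi n) * (recip_int p (n - i) * euler_int p i)) has_sum 0) UNIV" for n d
  proof -
    assume d: "((\<lambda>i. p powi i * recip_int p (n - 1 - i) * euler_int p i) has_sum d) UNIV"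
    have "bij_betw (\<lambda>i::int. i - 1) UNIV UNIV"
      by (rule bij_betw_byWitness[of _ "\<lambda>i. i + 1"]) auto
    then have "((\<lambda>i. p powi (i-1) * recip_int p (n - 1 - (i-1)) * euler_int p (i-1)) has_sum d) UNIV"
      using d by (subst has_sum_reindex_bij_betw) auto
    then have "((\<lambda>i. p powi i * recip_int p (n - 1 - i) * euler_int p i +
              - (p powi (i-1) * recip_int p (n - 1 - (i-1)) * euler_int p (i-1))) has_sum (d + - d))
                  UNIV"
      using d by (intro has_sum_add has_sum_uminusI)
    moreover have "p powi i * recip_int p (n - 1 - i) * euler_int p i +
              - (p powi (i-1) * recip_int p (n - 1 - (i-1)) * euler_int p (i-1))
           = (1 - p powi n) * (recip_int p (n - i) * euler_int p i)" for i
    proof -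
      have n: "p powi n = p powi i * p powi (n - i)"
        using p by (simp flip: power_int_add)
      have "p powi i * recip_int p (n - 1 - i) * euler_int p i - p powi (i-1)
          * recip_int p (n - 1 - (i-1)) * euler_int p (i-1)
         = p powi i * ((1 - p powi (n - i)) * recip_int p (n - i)) * euler_int p i
           + recip_int p (n - i) * ((1 - p powi i) * euler_int p i)"
        unfolding recip_int_rec[OF p] euler_int_rec[OF p] by (simp add: algebra_simps)
      also have "\<dots> = (1 - p powi n) * (recip_int p (n - i) * euler_int p i)"
        unfolding n by (simp add: algebra_simps)
      finally show ?thesis by simp
    qed
    ultimately show ?thesis by simp
  qed
  have "((\<lambda>i. p powi i * recip_int p (n - 1 - i) * euler_int p i) has_sum
          (\<Sum>i\<in>{0..n-1}. p powi i * recip_int p (n - 1 - i) * euler_int p i)) UNIV" for n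
    by (rule finite_int_support) (auto simp: recip_int_def euler_int_def)
  from c'[OF this] have "((\<lambda>i. (1 - p powi n) * (recip_int p (n - i) * euler_int p i))
      has_sum 0) UNIV" .
  then have "(1 - p powi n) * c n = 0"
    using has_sum_unique[OF has_sum_cmult_right[OF c]] by simp
  moreover have "p powi n \<noteq> 1" if "n \<noteq> 0"
    using that p power_int_strict_decreasing[of 0 n p] power_int_strict_decreasing[of n 0 p]
    by (cases "n < 0") auto
  moreover have "c 0 = 1"
    by (simp add: c_def recip_int_def euler_int_def euler_coeff_def q_pochhammer_def numeral_2_eq_2)
  ultimately have "c n = (if n = 0 then 1 else 0)" by auto
  then show ?thesis using c[of n] by simp
qed

section \<open>Orthogonality of the Hahn-Exton q-Bessel functions\<close>

lemma abs_summable_on_times: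
  fixes f :: "'a \<Rightarrow> 'c::real_normed_div_algebra" and g :: "'b \<Rightarrow> 'c"
  assumes f: "(\<lambda>x. norm (f x)) summable_on UNIV" and g: "(\<lambda>y. norm (g y)) summable_on UNIV"
  shows "(\<lambda>z. norm (case z of (x, y) \<Rightarrow> f x * g y)) summable_on UNIV"
proof -
  have "(\<lambda>(x, y). norm (f x) * norm (g y)) summable_on (SIGMA x:UNIV. UNIV)"
  proof (rule summable_on_SigmaI)
    fix x
    show "((\<lambda>y. case (x, y) of (x, y) \<Rightarrow> norm (f x) * norm (g y))
            has_sum norm (f x) * infsum (\<lambda>y. norm (g y)) UNIV) UNIV"
      using g by (auto intro!: has_sum_cmult_right)
    show "(\<lambda>x. norm (f x) * infsum (\<lambda>y. norm (g y)) UNIV) summable_on UNIV"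
      by (intro summable_on_cmult_left f)
  qed auto
  then show ?thesis
    by (simp add: case_prod_unfold norm_mult)
qed

lemma has_sum_times:
  fixes f :: "'a \<Rightarrow> 'c::{real_normed_div_algebra,banach}" and g :: "'b \<Rightarrow> 'c"
  assumes f: "(f has_sum a) UNIV" and g: "(g has_sum b) UNIV"
    and f': "(\<lambda>x. norm (f x)) summable_on UNIV" and g': "(\<lambda>y. norm (g y)) summable_on UNIV"
  shows "((\<lambda>(x, y). f x * g y) has_sum a * b) UNIV"
proof -
  have "((\<lambda>(x, y). f x * g y) has_sum a * b) (SIGMA x:UNIV. UNIV)"
  proof (rule has_sum_SigmaI)
    show "((\<lambda>y. case (x, y) of (x, y) \<Rightarrow> f x * g y) has_sum f x * b) UNIV" for x
      using g by (auto intro!: has_sum_cmult_right)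
    show "((\<lambda>x. f x * b) has_sum a * b) UNIV"
      by (intro has_sum_cmult_left f)
    show "(\<lambda>(x, y). f x * g y) summable_on (SIGMA x:UNIV. UNIV)"
      using abs_summable_summable[OF abs_summable_on_times[OF f' g']] by simp
  qed
  then show ?thesis by simp
qed

lemma has_sum_times_real:
  fixes f :: "'a \<Rightarrow> real" and g :: "'b \<Rightarrow> real"
  assumes "(f has_sum a) UNIV" "(g has_sum b) UNIV"
  shows "((\<lambda>(x, y). f x * g y) has_sum a * b) UNIV"
  by (intro has_sum_times assms)
     (use assms[THEN has_sum_imp_summable] in \<open>simp_all only:
         summable_on_iff_abs_summable_on_real[symmetric]\<close>)

lemma summable_on_times_real:
  fixes f :: "'a \<Rightarrow> real" and g :: "'b \<Rightarrow> real"
  assumes "f summable_on UNIV" "g summable_on UNIV"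
  shows "(\<lambda>(x, y). f x * g y) summable_on UNIV"
  using has_sum_times_real[OF has_sum_infsum[OF assms(1)] has_sum_infsum[OF assms(2)]]
  by (rule has_sum_imp_summable)

text \<open>The Laurent coefficients of \<open>(w/t; p)\<^sub>\<infinity> / (t; p)\<^sub>\<infinity>\<close> in the annulus \<open>0 < \<bar>t\<bar> < 1\<close>. Up to a
constant they are the values of the \<open>q\<close>-Bessel function on the lattice, see \<open>bessel_seq_series\<close>.\<close>
definition bessel_seq :: "real \<Rightarrow> real \<Rightarrow> int \<Rightarrow> real" where
  "bessel_seq p w k = (\<Sum>\<^sub>\<infinity>i. recip_int p (k + i) * euler_int p i * w powi i)"

lemma bessel_seq_abs_summable:
  assumes p: "0 < p" "p < 1"
  shows "(\<lambda>i. norm (recip_int p (k + i) * euler_int p i * w powi i)) summable_on UNIV"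
    and "(\<Sum>\<^sub>\<infinity>i. norm (recip_int p (k + i) * euler_int p i * w powi i))
           \<le> 1 / q_pochhammer_inf p p * (\<Sum>\<^sub>\<infinity>i. \<bar>euler_int p i * w powi i\<bar>)"
proof -
  have le: "norm (recip_int p (k + i) * euler_int p i * w powi i)
              \<le> 1 / q_pochhammer_inf p p * \<bar>euler_int p i * w powi i\<bar>" for i
    using mult_right_mono[OF recip_int_bound[OF p, of "k + i"], of "\<bar>euler_int p i * w powi i\<bar>"]
    by (simp add: abs_mult mult.assoc)
  have majorant: "(\<lambda>i. 1 / q_pochhammer_inf p p * \<bar>euler_int p i * w powi i\<bar>) summable_on UNIV"
    by (intro summable_on_cmult_right euler_int_abs_summable p)
  show summable: "(\<lambda>i. norm (recip_int p (k + i) * euler_int p i * w powi i)) summable_on UNIV"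
    by (rule Infinite_Sum.abs_summable_on_comparison_test'[OF majorant le])
  show "(\<Sum>\<^sub>\<infinity>i. norm (recip_int p (k + i) * euler_int p i * w powi i))
          \<le> 1 / q_pochhammer_inf p p * (\<Sum>\<^sub>\<infinity>i. \<bar>euler_int p i * w powi i\<bar>)"
    using infsum_mono[OF summable majorant le] unfolding infsum_cmult_right' .
qed

lemma bessel_seq_has_sum:
  assumes p: "0 < p" "p < 1"
  shows "((\<lambda>i. recip_int p (k + i) * euler_int p i * w powi i) has_sum bessel_seq p w k) UNIV"
  unfolding bessel_seq_def
  by (rule has_sum_infsum[OF abs_summable_summable[OF bessel_seq_abs_summable(1)[OF p]]])

lemma bessel_seq_bound:
  assumes p: "0 < p" "p < 1"
  shows "\<bar>bessel_seq p w k\<bar> \<le> 1 / q_pochhammer_inf p p * (\<Sum>\<^sub>\<infinity>i. \<bar>euler_int p i * w powi i\<bar>)"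
  using norm_infsum_bound[OF bessel_seq_abs_summable(1)[OF p]] bessel_seq_abs_summable(2)[OF p]
  unfolding bessel_seq_def real_norm_def by (rule order_trans)

text \<open>With \<open>G t = (w/t; p)\<^sub>\<infinity> / (t; p)\<^sub>\<infinity>\<close>, this is the coefficient of \<open>t powi d\<close> in \<open>G t * G (w/t)
= 1\<close>. The proof compares coefficients directly: substituting the series of both factors gives a
triple series over \<open>b\<close>, \<open>k\<close>, \<open>l\<close>, and in the variables \<open>M = b + k + l\<close>, \<open>k\<close>, \<open>l\<close> the sums over \<open>k\<close>
and \<open>l\<close> separate into two convolutions of \<open>euler_int\<close> with \<open>recip_int\<close>, each of which is a
Kronecker delta.\<close>
lemma bessel_seq_orthogonal:
  assumes p: "0 < p" "p < 1" and w: "0 < w" "w < 1"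
  shows "((\<lambda>b. w powi b * (bessel_seq p w (b + d) * bessel_seq p w b))
           has_sum (if d = 0 then 1 else 0)) UNIV"
proof -
  define F where "F = (\<lambda>(M, k, l). w powi M * ((recip_int p (M - k) * euler_int p k) *
                                   (recip_int p (M + d - l) * euler_int p l)))"
  define A where "A = 1 / q_pochhammer_inf p p"
  have sumE: "(\<lambda>i. \<bar>euler_int p i\<bar>) summable_on UNIV"
    using euler_int_abs_summable[OF p, of 1] by simp
  have "(\<lambda>i::int. if i < 0 then 0 else w ^ nat i) summable_on UNIV"
  proof -
    have "summable (\<lambda>n. norm (w ^ n))"
      using w by (simp add: summable_geometric)
    then have "(\<lambda>n. w ^ n) summable_on UNIV"
      by (rule norm_summable_imp_summable_on)
    then show ?thesis
      using has_sum_int_nat[of "\<lambda>n. w ^ n"] by (auto simp: summable_on_def)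
  qed
  then have "(\<lambda>(M::int, k, l). (if M < 0 then 0 else w ^ nat M) * (\<bar>euler_int p k\<bar> * \<bar>euler_int p l\<bar>))
          summable_on UNIV"
    using summable_on_times_real[OF _ summable_on_times_real[OF sumE sumE]]
        by (simp add: case_prod_unfold)
  then have "(\<lambda>z. A\<^sup>2 * (case z of (M::int, k, l) \<Rightarrow> (if M < 0 then 0 else w ^ nat M) *
          (\<bar>euler_int p k\<bar> * \<bar>euler_int p l\<bar>))) summable_on UNIV"
    by (rule summable_on_cmult_right)
  then have "(\<lambda>z. norm (F z)) summable_on UNIV"
  proof (rule Infinite_Sum.abs_summable_on_comparison_test', safe)
    fix M k l :: int
    have R: "\<bar>recip_int p i\<bar> \<le> A" for i
      unfolding A_def by (rule recip_int_bound[OF p])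
    (* For M < 0 one of k and M - k is negative, so F vanishes there; this leaves only the
       convergent half of the geometric series in w. *)
    show "norm (F (M, k, l)) \<le> A\<^sup>2 * ((if M < 0 then 0 else w ^ nat M)
        * (\<bar>euler_int p k\<bar> * \<bar>euler_int p l\<bar>))"
    proof (cases "M < 0")
      case True
      then have "recip_int p (M - k) * euler_int p k = 0"
        by (auto simp: recip_int_def euler_int_def)
      then show ?thesis using True by (simp add: F_def)
    next
      case False
      have "norm (F (M, k, l)) = (\<bar>recip_int p (M - k)\<bar> * \<bar>recip_int p (M + d - l)\<bar>) *
               (w ^ nat M * (\<bar>euler_int p k\<bar> * \<bar>euler_int p l\<bar>))"
        using w False by (simp add: F_def abs_mult power_int_def)
      also have "\<dots> \<le> (A * A) * (w ^ nat M * (\<bar>euler_int p k\<bar> * \<bar>euler_int p l\<bar>))"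
        using w R order_trans[OF abs_ge_zero R] by (intro mult_right_mono mult_mono) auto
      finally show ?thesis using False by (simp add: power2_eq_square)
    qed
  qed
  then have "F summable_on UNIV"
    by (rule abs_summable_summable)
  then obtain S where S: "(F has_sum S) UNIV"
    by (auto simp: summable_on_def)
  have "((\<lambda>M. w powi M * ((if M = 0 then 1 else 0) * (if M + d = 0 then 1 else 0))) has_sum S) UNIV"
  proof (rule has_sum_SigmaD)
    show "(F has_sum S) (SIGMA x:UNIV. UNIV)" using S by simp
    show "((\<lambda>y. F (M, y)) has_sum w powi M
        * ((if M = 0 then 1 else 0) * (if M + d = 0 then 1 else 0))) UNIV" for M
      using has_sum_cmult_right[OF has_sum_times_real[OF euler_recip_convolution[OF p, of M]
          euler_recip_convolution[OF p, of "M + d"]], of "w powi M"]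
      by (simp add: F_def case_prod_unfold)
  qed
  moreover have "((\<lambda>M. w powi M * ((if M = 0 then 1 else 0) * (if M + d = 0 then 1 else 0)))
      has_sum (if d = 0 then 1 else 0)) UNIV"
    by (rule has_sum_finite_neutralI[of "{0}"]) auto
  ultimately have Sd: "S = (if d = 0 then 1 else 0)"
    by (rule has_sum_unique)
  (* Back in the variables b, k, l the two inner sums define bessel_seq at b + d and at b. *)
  have "bij_betw (\<lambda>(b, k, l). (b + k + l, k, l) :: int \<times> int \<times> int) UNIV UNIV"
    by (rule bij_betw_byWitness[of _ "\<lambda>(M, k, l). (M - k - l, k, l)"]) auto
  then have "((\<lambda>z. F (case z of (b, k, l) \<Rightarrow> (b + k + l, k, l))) has_sum S) UNIV"
    using S by (subst has_sum_reindex_bij_betw)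
  moreover have "F (case z of (b, k, l) \<Rightarrow> (b + k + l, k, l)) =
      (case z of (b, k, l) \<Rightarrow> w powi b * ((recip_int p (b + d + k) * euler_int p k * w powi k) *
                                   (recip_int p (b + l) * euler_int p l * w powi l)))" for z
    using w by (auto simp: F_def power_int_add case_prod_unfold algebra_simps)
  ultimately have S': "((\<lambda>(b, k, l). w powi b
      * ((recip_int p (b + d + k) * euler_int p k * w powi k) *
                                   (recip_int p (b + l) * euler_int p l * w powi l)))
                                       has_sum S) (SIGMA x:UNIV. UNIV)"
    by simp
  have "((\<lambda>b. w powi b * (bessel_seq p w (b + d) * bessel_seq p w b)) has_sum S) UNIV"
  proof (rule has_sum_SigmaD[OF S'])
    fix b
    show "((\<lambda>y. case (b, y) of (b, k, l) \<Rightarrow> w powi b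
        * ((recip_int p (b + d + k) * euler_int p k * w powi k) *
                                   (recip_int p (b + l) * euler_int p l * w powi l)))
            has_sum w powi b * (bessel_seq p w (b + d) * bessel_seq p w b)) UNIV"
      using has_sum_cmult_right[OF has_sum_times_real[OF bessel_seq_has_sum[OF p, of "b+d" w]
          bessel_seq_has_sum[OF p, of b w]], of "w powi b"]
      by (simp add: case_prod_unfold)
  qed
  then show ?thesis unfolding Sd .
qed

text \<open>The series of the Hahn-Exton \<open>q\<close>-Bessel function at a lattice point. Expressing \<open>recip_int\<close>
by an infinite product and expanding that product by Euler's formula gives a double series that is
summed over \<open>i\<close> first; the inner sum is \<open>(w p^n; p)\<^sub>\<infinity> = (w; p)\<^sub>\<infinity> / (w; p)\<^sub>n\<close>, again by Euler's
formula.\<close>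
lemma bessel_seq_series:
  assumes p: "0 < p" "p < 1" and w: "0 < w" "w < 1"
  shows "(\<lambda>n. (-1) ^ n * p ^ (n choose 2) / (q_pochhammer p p n * q_pochhammer w p n)
      * (p powi (k + 1)) ^ n)
           sums (q_pochhammer_inf p p / q_pochhammer_inf w p * bessel_seq p w k)"
proof -
  define H where "H = (\<lambda>(i, n). euler_int p i * w powi i
      * (euler_coeff p n * (p powi (k + i + 1)) ^ n))"
  have pp: "0 < q_pochhammer_inf p p" "0 < q_pochhammer_inf w p" "\<And>n. 0 < q_pochhammer w p n"
    using p w by (auto intro!: q_pochhammer_inf_pos q_pochhammer_pos)
  have "summable (\<lambda>n. norm \<bar>euler_coeff p n * (p powi (k + 1)) ^ n\<bar>)"
    using euler_coeff_summable[OF p] by simp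
  then have "(\<lambda>n. \<bar>euler_coeff p n * (p powi (k + 1)) ^ n\<bar>) summable_on UNIV"
    by (rule norm_summable_imp_summable_on)
  from summable_on_times_real[OF euler_int_abs_summable[OF p, of w] this]
  have "(\<lambda>z. norm (H z)) summable_on UNIV"
  proof (rule Infinite_Sum.abs_summable_on_comparison_test', safe)
    fix i :: int and n :: nat
    show "norm (H (i, n)) \<le> \<bar>euler_int p i * w powi i\<bar> * \<bar>euler_coeff p n * (p powi (k + 1)) ^ n\<bar>"
    proof (cases "i < 0")
      case True
      then show ?thesis by (simp add: H_def euler_int_def)
    next
      case False
      have "k + i + 1 = (k + 1) + i" by simp
      then have e: "p powi (k + i + 1) = p powi (k + 1) * p powi i"
        using p power_int_add[of p "k + 1" i] by (simp only:) simp
      have "p powi i \<le> 1"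
        using False p by (simp add: power_int_def power_le_one)
      then have "(p powi (k + i + 1)) ^ n \<le> (p powi (k + 1)) ^ n"
        using p unfolding e by (intro power_mono) (auto intro!: mult_left_le)
      then show ?thesis
        using p by (auto simp: H_def abs_mult intro!: mult_left_mono)
    qed
  qed
  then have "H summable_on UNIV"
    by (rule abs_summable_summable)
  then obtain S where S: "(H has_sum S) UNIV"
    by (auto simp: summable_on_def)
  have "((\<lambda>i. q_pochhammer_inf p p * (recip_int p (k + i) * euler_int p i * w powi i))
      has_sum S) UNIV"
  proof (rule has_sum_SigmaD)
    show "(H has_sum S) (SIGMA i:UNIV. UNIV)" using S by simp
    show "((\<lambda>n. H (i, n)) has_sum q_pochhammer_inf p p
        * (recip_int p (k + i) * euler_int p i * w powi i)) UNIV" for i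
      using has_sum_cmult_right[OF euler_has_sum[OF p, of "p powi (k + i + 1)"], of "euler_int p i
          * w powi i"]
        pp by (simp add: H_def recip_int_eq[OF p] mult_ac)
  qed
  moreover have "((\<lambda>i. q_pochhammer_inf p p * (recip_int p (k + i) * euler_int p i * w powi i))
        has_sum q_pochhammer_inf p p * bessel_seq p w k) UNIV"
    by (intro has_sum_cmult_right bessel_seq_has_sum p)
  ultimately have S_eq: "S = q_pochhammer_inf p p * bessel_seq p w k"
    by (rule has_sum_unique)
  have "((\<lambda>(n, i). H (i, n)) has_sum S) (UNIV \<times> UNIV)"
    using S has_sum_swap[where f = H and A = UNIV and B = UNIV] by simp
  then have "((\<lambda>n. euler_coeff p n * (p powi (k + 1)) ^ n * q_pochhammer_inf (w * p ^ n) p)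
      has_sum S) UNIV"
  proof (rule has_sum_SigmaD)
    fix n :: nat
    have e: "H (i, n) = euler_coeff p n * (p powi (k + 1)) ^ n
        * (euler_int p i * (w * p ^ n) powi i)" for i
    proof -
      have "(p powi (k + i + 1)) ^ n = (p powi (k + 1)) ^ n * (p powi i) ^ n"
        using p power_int_add[of p "k + 1" i] by (simp add: power_mult_distrib add_ac)
      moreover have "(p powi i) ^ n = (p ^ n) powi i"
        by (metis mult.commute power_int_mult power_int_of_nat)
      ultimately show ?thesis by (simp add: H_def power_int_mult_distrib)
    qed
    show "((\<lambda>i. case (n, i) of (n, i) \<Rightarrow> H (i, n)) has_sum
            euler_coeff p n * (p powi (k + 1)) ^ n * q_pochhammer_inf (w * p ^ n) p) UNIV"
      unfolding prod.case e by (intro has_sum_cmult_right euler_int_has_sum p)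
  qed
  then have "(\<lambda>n. euler_coeff p n * (p powi (k + 1)) ^ n * q_pochhammer_inf (w * p ^ n) p) sums S"
    by (rule has_sum_imp_sums)
  then have "(\<lambda>n. euler_coeff p n * (p powi (k + 1)) ^ n * q_pochhammer_inf (w * p ^ n) p
      / q_pochhammer_inf w p)
       sums (S / q_pochhammer_inf w p)"
    by (rule sums_divide)
  moreover have "euler_coeff p n * (p powi (k + 1)) ^ n * q_pochhammer_inf (w * p ^ n) p
      / q_pochhammer_inf w p
     = (-1) ^ n * p ^ (n choose 2) / (q_pochhammer p p n * q_pochhammer w p n)
         * (p powi (k + 1)) ^ n" for n
  proof -
    have "q_pochhammer_inf (w * p ^ n) p / q_pochhammer_inf w p = 1 / q_pochhammer w p n"
      using q_pochhammer_inf_split[OF p, of w n] pp(2) pp(3)[of n] by (auto simp: field_simps)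
    then have "euler_coeff p n * (p powi (k + 1)) ^ n
        * (q_pochhammer_inf (w * p ^ n) p / q_pochhammer_inf w p)
        = euler_coeff p n * (p powi (k + 1)) ^ n * (1 / q_pochhammer w p n)"
      by (rule arg_cong)
    then show ?thesis
      by (simp add: euler_coeff_def)
  qed
  ultimately show ?thesis
    by (simp add: S_eq)
qed

text \<open>The weight \<open>v powi k\<close>, with \<open>v\<^sup>2\<close> for the parameter \<open>w\<close>, distributes the factor \<open>w powi b\<close>
of the orthogonality relation evenly between its two Bessel functions.\<close>
definition bessel_kernel :: "real \<Rightarrow> real \<Rightarrow> int \<Rightarrow> real" where
  "bessel_kernel p v k = v powi k * bessel_seq p (v\<^sup>2) k"

lemma bessel_kernel_orthonormal:
  assumes p: "0 < p" "p < 1" and v: "0 < v" "v < 1"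
  shows "((\<lambda>k. bessel_kernel p v (n + k) * bessel_kernel p v (m + k))
           has_sum (if n = m then 1 else 0)) UNIV"
proof -
  have w: "0 < v\<^sup>2" "v\<^sup>2 < 1"
    using v by (auto simp: power_less_one_iff)
  have "((\<lambda>b. v powi (n - m) * ((v\<^sup>2) powi b
      * (bessel_seq p (v\<^sup>2) (b + (n - m)) * bessel_seq p (v\<^sup>2) b)))
           has_sum v powi (n - m) * (if n - m = 0 then 1 else 0)) UNIV"
    by (intro has_sum_cmult_right bessel_seq_orthogonal p w)
  moreover have "bij_betw (\<lambda>k. m + k) UNIV (UNIV :: int set)"
    by (rule bij_betw_byWitness[of _ "\<lambda>k. k - m"]) auto
  ultimately have "((\<lambda>k. v powi (n - m) * ((v\<^sup>2) powi (m + k)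
      * (bessel_seq p (v\<^sup>2) ((m + k) + (n - m)) * bessel_seq p (v\<^sup>2) (m + k))))
           has_sum v powi (n - m) * (if n - m = 0 then 1 else 0)) UNIV"
    by (subst has_sum_reindex_bij_betw[where g = "\<lambda>k. m + k"])
  moreover have "v powi (n - m) * ((v\<^sup>2) powi (m + k)
      * (bessel_seq p (v\<^sup>2) ((m + k) + (n - m)) * bessel_seq p (v\<^sup>2) (m + k)))
      = bessel_kernel p v (n + k) * bessel_kernel p v (m + k)" for k
  proof -
    have "v powi (n - m) * (v\<^sup>2) powi (m + k) = v powi (n + k) * v powi (m + k)"
    proof -
      have "v powi (n - m) * (v\<^sup>2) powi (m + k) = v powi (n - m) * v powi (2 * (m + k))"
        by (metis power_int_mult power_int_numeral)
      also have "\<dots> = v powi (n - m + 2 * (m + k))"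
        using v by (subst power_int_add) auto
      also have "n - m + 2 * (m + k) = (n + k) + (m + k)" by simp
      also have "v powi \<dots> = v powi (n + k) * v powi (m + k)"
        using v by (subst power_int_add) auto
      finally show ?thesis .
    qed
    note v_powers = this
    have "m + k + (n - m) = n + k" by simp
    then have "v powi (n - m) * ((v\<^sup>2) powi (m + k)
        * (bessel_seq p (v\<^sup>2) ((m + k) + (n - m)) * bessel_seq p (v\<^sup>2) (m + k)))
      = (v powi (n - m) * (v\<^sup>2) powi (m + k))
          * (bessel_seq p (v\<^sup>2) (n + k) * bessel_seq p (v\<^sup>2) (m + k))"
      by (simp only: mult.assoc)
    also have "\<dots> = bessel_kernel p v (n + k) * bessel_kernel p v (m + k)"
      unfolding v_powers bessel_kernel_def by (simp only: mult_ac)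
    finally show ?thesis .
  qed
  ultimately show ?thesis by (cases "n = m") auto
qed

section \<open>Square-summable sequences and unitary Hankel operators\<close>

lemma has_sum_finite_sum:
  fixes f :: "'i \<Rightarrow> 'a \<Rightarrow> 'b::topological_comm_monoid_add"
  assumes "finite F" "\<And>i. i \<in> F \<Longrightarrow> (f i has_sum s i) A"
  shows "((\<lambda>x. \<Sum>i\<in>F. f i x) has_sum (\<Sum>i\<in>F. s i)) A"
  using assms by (induction F) (auto intro!: has_sum_add)

definition l2 :: "('a \<Rightarrow> complex) set" where
  "l2 = {x. (\<lambda>n. (cmod (x n))\<^sup>2) summable_on UNIV}"

definition l2_inner :: "('a \<Rightarrow> complex) \<Rightarrow> ('a \<Rightarrow> complex) \<Rightarrow> complex" where
  "l2_inner x y = (\<Sum>\<^sub>\<infinity>n. x n * cnj (y n))"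

definition l2_sq :: "('a \<Rightarrow> complex) \<Rightarrow> real" where
  "l2_sq x = (\<Sum>\<^sub>\<infinity>n. (cmod (x n))\<^sup>2)"

lemma l2_prod_le: "cmod (a * cnj b) \<le> (cmod a)\<^sup>2 + (cmod b)\<^sup>2"
proof -
  have "2 * (cmod a * cmod b) \<le> (cmod a)\<^sup>2 + (cmod b)\<^sup>2"
    using sum_squares_bound[of "cmod a" "cmod b"] by simp
  moreover have "0 \<le> cmod a * cmod b" by simp
  ultimately have "cmod a * cmod b \<le> (cmod a)\<^sup>2 + (cmod b)\<^sup>2"
    by linarith
  then show ?thesis by (simp add: norm_mult)
qed

lemma l2_abs_summable:
  assumes "x \<in> l2" "y \<in> l2"
  shows "(\<lambda>n. norm (x n * cnj (y n))) summable_on UNIV"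
proof (rule Infinite_Sum.abs_summable_on_comparison_test')
  show "(\<lambda>n. (cmod (x n))\<^sup>2 + (cmod (y n))\<^sup>2) summable_on UNIV"
    using assms by (auto simp: l2_def intro: summable_on_add)
qed (rule l2_prod_le)

lemma l2_inner_has_sum:
  assumes "x \<in> l2" "y \<in> l2"
  shows "((\<lambda>n. x n * cnj (y n)) has_sum l2_inner x y) UNIV"
  unfolding l2_inner_def by (rule has_sum_infsum[OF
      abs_summable_summable[OF l2_abs_summable[OF assms]]])

lemma l2_sq_has_sum: "x \<in> l2 \<Longrightarrow> ((\<lambda>n. (cmod (x n))\<^sup>2) has_sum l2_sq x) UNIV"
  by (simp add: l2_def l2_sq_def)

lemma l2_inner_self_has_sum:
  assumes "x \<in> l2"
  shows "((\<lambda>n. x n * cnj (x n)) has_sum of_real (l2_sq x)) UNIV"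
proof -
  have "((\<lambda>n. complex_of_real ((cmod (x n))\<^sup>2)) has_sum of_real (l2_sq x)) UNIV"
    by (intro has_sum_of_real l2_sq_has_sum assms)
  then show ?thesis
    by (simp add: complex_norm_square del: of_real_power)
qed

lemma l2_mult_bounded:
  assumes "x \<in> l2" "\<And>n. cmod (c n) \<le> B"
  shows "(\<lambda>n. x n * c n) \<in> l2"
proof -
  have "(cmod (x n * c n))\<^sup>2 \<le> B\<^sup>2 * (cmod (x n))\<^sup>2" for n
    using assms(2)[of n] by (auto simp: norm_mult power_mult_distrib mult.commute[of "B\<^sup>2"] intro!:
        mult_left_mono power_mono)
  moreover have "(\<lambda>n. B\<^sup>2 * (cmod (x n))\<^sup>2) summable_on UNIV"
    using assms by (auto simp: l2_def intro!: summable_on_cmult_right)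
  ultimately show ?thesis
    unfolding l2_def by (auto intro: summable_on_comparison_test)
qed

lemma l2_Cauchy_Schwarz:
  assumes "x \<in> l2" "y \<in> l2"
  shows "cmod (l2_inner x y) \<le> sqrt (l2_sq x * l2_sq y)"
proof -
  have "cmod (l2_inner x y) \<le> (\<Sum>\<^sub>\<infinity>n. norm (x n * cnj (y n)))"
    unfolding l2_inner_def by (rule norm_infsum_bound[OF l2_abs_summable[OF assms]])
  also have "\<dots> \<le> sqrt (l2_sq x * l2_sq y)"
  proof (rule infsum_le_finite_sums[OF l2_abs_summable[OF assms]])
    fix F :: "'a set" assume F: "finite F" "F \<subseteq> UNIV"
    have "(\<Sum>n\<in>F. cmod (x n) * cmod (y n))\<^sup>2 \<le> (\<Sum>n\<in>F. (cmod (x n))\<^sup>2) * (\<Sum>n\<in>F. (cmod (y n))\<^sup>2)"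
      by (rule Cauchy_Schwarz_ineq_sum)
    also have "\<dots> \<le> l2_sq x * l2_sq y"
      using assms F by (intro mult_mono finite_sum_le_infsum sum_nonneg infsum_nonneg)
                       (auto simp: l2_def l2_sq_def intro!: finite_sum_le_infsum infsum_nonneg)
    finally show "(\<Sum>n\<in>F. norm (x n * cnj (y n))) \<le> sqrt (l2_sq x * l2_sq y)"
      by (simp add: norm_mult real_le_rsqrt)
  qed
  finally show ?thesis .
qed

text \<open>Orthonormality of the rows suffices for unitarity, because a Hankel matrix is symmetric, so
that its columns are orthonormal too.\<close>
locale hankel_unitary =
  fixes h :: "int \<Rightarrow> real"
  assumes orthonormal: "((\<lambda>k. h (n + k) * h (m + k)) has_sum (if n = m then 1 else 0)) UNIV"
begin

definition hankel :: "(int \<Rightarrow> complex) \<Rightarrow> int \<Rightarrow> complex" where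
  "hankel x n = (\<Sum>\<^sub>\<infinity>m. of_real (h (n + m)) * x m)"

lemma row_l2: "(\<lambda>m. complex_of_real (h (n + m))) \<in> l2"
  using has_sum_imp_summable[OF orthonormal[of n n]] by (simp add: l2_def power2_eq_square)

lemma hankel_has_sum:
  assumes "x \<in> l2"
  shows "((\<lambda>m. of_real (h (n + m)) * x m) has_sum hankel x n) UNIV"
proof -
  have "(\<lambda>m. norm (x m * cnj (of_real (h (n + m))))) summable_on UNIV"
    by (rule l2_abs_summable[OF assms row_l2])
  then have "(\<lambda>m. norm (of_real (h (n + m)) * x m)) summable_on UNIV"
    by (simp add: norm_mult mult.commute)
  then have "(\<lambda>m. of_real (h (n + m)) * x m) summable_on UNIV"
    by (rule abs_summable_summable)
  then show ?thesis
    unfolding hankel_def by simp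
qed

lemma orthonormal_complex:
  "((\<lambda>k. complex_of_real (h (n + k)) * complex_of_real (h (m + k)))
      has_sum (if n = m then 1 else 0)) UNIV"
proof -
  have "((\<lambda>k. complex_of_real (h (n + k) * h (m + k))) has_sum of_real (if n = m then 1 else 0)) UNIV"
    by (intro has_sum_of_real orthonormal)
  then show ?thesis by (simp split: if_splits)
qed

text \<open>The distance of \<open>x\<close> from its projection \<open>z\<close> onto the span of the rows with index in \<open>F\<close> has
a nonnegative square. The entries of \<open>hankel x\<close> are the coordinates of \<open>x\<close> with respect to the
rows.\<close>
lemma bessel_inequality:
  assumes x: "x \<in> l2" and F: "finite F"
  shows "(\<Sum>n\<in>F. (cmod (hankel x n))\<^sup>2) \<le> l2_sq x"
proof -
  define z where "z m = (\<Sum>n\<in>F. hankel x n * of_real (h (n + m)))" for m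
  define S where "S = (\<Sum>n\<in>F. hankel x n * cnj (hankel x n))"
  have xx: "((\<lambda>m. x m * cnj (x m)) has_sum of_real (l2_sq x)) UNIV"
    by (rule l2_inner_self_has_sum[OF x])
  have xz: "((\<lambda>m. x m * cnj (z m)) has_sum S) UNIV"
  proof -
    have "((\<lambda>m. \<Sum>n\<in>F. cnj (hankel x n) * (of_real (h (n + m)) * x m))
        has_sum (\<Sum>n\<in>F. cnj (hankel x n) * hankel x n)) UNIV"
      by (intro has_sum_finite_sum F has_sum_cmult_right hankel_has_sum x)
    then show ?thesis
      by (simp add: z_def S_def cnj_sum sum_distrib_left mult_ac)
  qed
  then have zx: "((\<lambda>m. z m * cnj (x m)) has_sum S) UNIV"
  proof -
    have "((\<lambda>m. cnj (x m * cnj (z m))) has_sum cnj S) UNIV"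
      using xz by (subst has_sum_cnj_iff)
    then show ?thesis by (simp add: S_def mult_ac)
  qed
  have zz: "((\<lambda>m. z m * cnj (z m)) has_sum S) UNIV"
  proof -
    have "((\<lambda>m. \<Sum>n\<in>F. \<Sum>n'\<in>F. hankel x n * cnj (hankel x n')
        * (of_real (h (n + m)) * of_real (h (n' + m))))
          has_sum (\<Sum>n\<in>F. \<Sum>n'\<in>F. hankel x n * cnj (hankel x n') * (if n = n' then 1 else 0))) UNIV"
      by (intro has_sum_finite_sum F has_sum_cmult_right orthonormal_complex)
    moreover have "(\<Sum>n\<in>F. \<Sum>n'\<in>F. hankel x n * cnj (hankel x n') * (if n = n' then 1 else 0)) = S"
      using F by (simp add: S_def if_distrib sum.delta cong: if_cong)
    moreover have "(\<Sum>n\<in>F. \<Sum>n'\<in>F. hankel x n * cnj (hankel x n')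
        * (of_real (h (n + m)) * of_real (h (n' + m))))
        = z m * cnj (z m)" for m
      by (simp add: z_def cnj_sum sum_product mult_ac)
    ultimately show ?thesis by simp
  qed
  have "((\<lambda>m. (x m * cnj (x m) + - (x m * cnj (z m))) + (- (z m * cnj (x m)) + z m * cnj (z m)))
        has_sum ((of_real (l2_sq x) + - S) + (- S + S))) UNIV"
    by (intro has_sum_add has_sum_uminusI xx xz zx zz)
  moreover have "(x m * cnj (x m) + - (x m * cnj (z m))) + (- (z m * cnj (x m)) + z m * cnj (z m))
     = of_real ((cmod (x m - z m))\<^sup>2)" for m
    by (simp add: complex_norm_square algebra_simps del: of_real_power)
  moreover have "(of_real (l2_sq x) + - S) + (- S + S)
      = of_real (l2_sq x - (\<Sum>n\<in>F. (cmod (hankel x n))\<^sup>2))"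
    by (simp add: S_def complex_norm_square del: of_real_power)
  ultimately have "((\<lambda>m. complex_of_real ((cmod (x m - z m))\<^sup>2)) has_sum
      of_real (l2_sq x - (\<Sum>n\<in>F. (cmod (hankel x n))\<^sup>2))) UNIV"
    by simp
  then have "((\<lambda>m. (cmod (x m - z m))\<^sup>2) has_sum (l2_sq x - (\<Sum>n\<in>F. (cmod (hankel x n))\<^sup>2))) UNIV"
    by (subst (asm) has_sum_of_real_iff)
  then have "0 \<le> l2_sq x - (\<Sum>n\<in>F. (cmod (hankel x n))\<^sup>2)"
    by (rule has_sum_nonneg) simp
  then show ?thesis by simp
qed

lemma hankel_l2: assumes "x \<in> l2" shows "hankel x \<in> l2"
  unfolding l2_def mem_Collect_eq
  by (rule nonneg_bdd_above_summable_on)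
     (auto intro!: bdd_aboveI2[where M = "l2_sq x"] bessel_inequality assms)

lemma hankel_contraction: assumes "x \<in> l2" shows "l2_sq (hankel x) \<le> l2_sq x"
  unfolding l2_sq_def[of "hankel x"]
  using hankel_l2[OF assms] bessel_inequality[OF assms]
  by (intro infsum_le_finite_sums) (auto simp: l2_def)

text \<open>For finitely supported \<open>y\<close> this is an exchange of a finite with an infinite sum. The double
series for general \<open>y\<close> need not converge absolutely; instead \<open>y\<close> is cut off outside a finite set
\<open>B\<close>, and the Cauchy-Schwarz inequality together with the contraction property bounds the error by
the norm of the remainder \<open>r\<close>, which tends to \<open>0\<close>.\<close>
lemma hankel_self_adjoint:
  assumes x: "x \<in> l2" and y: "y \<in> l2"
  shows "l2_inner (hankel x) y = l2_inner x (hankel y)"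
proof -
  define f where "f k = hankel x k * cnj (y k)" for k
  have bound: "cmod (sum f B - l2_inner x (hankel y))
      \<le> sqrt (l2_sq x * (l2_sq y - (\<Sum>k\<in>B. (cmod (y k))\<^sup>2)))"
    if B: "finite B" for B
  proof -
    define r where "r k = (if k \<in> B then 0 else y k)" for k
    have rs: "((\<lambda>k. (cmod (r k))\<^sup>2) has_sum (l2_sq y - (\<Sum>k\<in>B. (cmod (y k))\<^sup>2))) UNIV"
    proof -
      have "((\<lambda>k. if k \<in> B then (cmod (y k))\<^sup>2 else 0) has_sum (\<Sum>k\<in>B. (cmod (y k))\<^sup>2)) UNIV"
        using B by (intro has_sum_finite_neutralI[of B]) auto
      then have "((\<lambda>k. (cmod (y k))\<^sup>2 + - (if k \<in> B then (cmod (y k))\<^sup>2 else 0))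
                 has_sum l2_sq y + - (\<Sum>k\<in>B. (cmod (y k))\<^sup>2)) UNIV"
        by (intro has_sum_add has_sum_uminusI l2_sq_has_sum y)
      moreover have "(cmod (y k))\<^sup>2 + - (if k \<in> B then (cmod (y k))\<^sup>2 else 0) = (cmod (r k))\<^sup>2" for k
        by (simp add: r_def)
      ultimately show ?thesis by simp
    qed
    then have r: "r \<in> l2" and r_sq: "l2_sq r = l2_sq y - (\<Sum>k\<in>B. (cmod (y k))\<^sup>2)"
      by (auto simp: l2_def l2_sq_def has_sum_iff)
    have hankel_y: "hankel y n = (\<Sum>k\<in>B. of_real (h (n + k)) * y k) + hankel r n" for n
    proof -
      have "((\<lambda>k. if k \<in> B then of_real (h (n + k)) * y k else 0)
          has_sum (\<Sum>k\<in>B. of_real (h (n + k)) * y k)) UNIV"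
        using B by (intro has_sum_finite_neutralI[of B]) auto
      then have "((\<lambda>k. (if k \<in> B then of_real (h (n + k)) * y k else 0) + of_real (h (n + k))
          * r k) has_sum
           (\<Sum>k\<in>B. of_real (h (n + k)) * y k) + hankel r n) UNIV"
        by (intro has_sum_add hankel_has_sum r)
      moreover have "(if k \<in> B then of_real (h (n + k)) * y k else 0) + of_real (h (n + k)) * r k
          = of_real (h (n + k)) * y k" for k
        by (simp add: r_def)
      ultimately show ?thesis
        using has_sum_unique[OF hankel_has_sum[OF y, of n]] by simp
    qed
    have "((\<lambda>n. \<Sum>k\<in>B. cnj (y k) * (of_real (h (k + n)) * x n))
        has_sum (\<Sum>k\<in>B. cnj (y k) * hankel x k)) UNIV"
      by (intro has_sum_finite_sum B has_sum_cmult_right hankel_has_sum x)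
    then have "((\<lambda>n. (\<Sum>k\<in>B. cnj (y k) * (of_real (h (k + n)) * x n)) + x n * cnj (hankel r n))
          has_sum (\<Sum>k\<in>B. cnj (y k) * hankel x k) + l2_inner x (hankel r)) UNIV"
      by (intro has_sum_add l2_inner_has_sum x hankel_l2 r)
    moreover have "(\<Sum>k\<in>B. cnj (y k) * (of_real (h (k + n)) * x n)) + x n * cnj (hankel r n) = x n
        * cnj (hankel y n)" for n
      by (simp add: hankel_y cnj_sum sum_distrib_left algebra_simps)
    ultimately have "l2_inner x (hankel y) = sum f B + l2_inner x (hankel r)"
      using has_sum_unique[OF l2_inner_has_sum[OF x hankel_l2[OF y]]]
          by (simp add: f_def mult.commute)
    then have "cmod (sum f B - l2_inner x (hankel y)) = cmod (l2_inner x (hankel r))"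
      by (simp add: norm_minus_commute)
    also have "\<dots> \<le> sqrt (l2_sq x * l2_sq (hankel r))"
      by (intro l2_Cauchy_Schwarz x hankel_l2 r)
    also have "\<dots> \<le> sqrt (l2_sq x * l2_sq r)"
      by (intro real_sqrt_le_mono mult_left_mono hankel_contraction r)
          (simp add: l2_sq_def infsum_nonneg)
    finally show ?thesis by (simp add: r_sq)
  qed
  have "((\<lambda>B. \<Sum>k\<in>B. (cmod (y k))\<^sup>2) \<longlongrightarrow> l2_sq y) (finite_subsets_at_top UNIV)"
    using l2_sq_has_sum[OF y] by (simp add: has_sum_def)
  then have "((\<lambda>B. sqrt (l2_sq x * (l2_sq y - (\<Sum>k\<in>B. (cmod (y k))\<^sup>2)))) \<longlongrightarrow> sqrt (l2_sq x
      * (l2_sq y - l2_sq y))) (finite_subsets_at_top UNIV)"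
    by (intro tendsto_intros)
  then have lim0: "((\<lambda>B. sqrt (l2_sq x * (l2_sq y - (\<Sum>k\<in>B. (cmod (y k))\<^sup>2)))) \<longlongrightarrow> 0)
      (finite_subsets_at_top UNIV)"
    by simp
  have "((\<lambda>B. sum f B - l2_inner x (hankel y)) \<longlongrightarrow> 0) (finite_subsets_at_top UNIV)"
    by (rule Lim_null_comparison[OF _ lim0])
        (auto intro!: eventually_finite_subsets_at_top_weakI bound)
  then have "(f has_sum l2_inner x (hankel y)) UNIV"
    unfolding has_sum_def by (subst Lim_null)
  moreover have "(f has_sum l2_inner (hankel x) y) UNIV"
    unfolding f_def by (intro l2_inner_has_sum hankel_l2 x y)
  ultimately show ?thesis
    by (rule has_sum_unique[rotated])
qed

text \<open>The entry of \<open>hankel (hankel x)\<close> at \<open>n\<close> is the inner product of \<open>hankel x\<close> with row \<open>n\<close>.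
Self-adjointness moves the operator to that row, which it maps to a unit vector by
orthonormality.\<close>
lemma hankel_involution:
  assumes x: "x \<in> l2"
  shows "hankel (hankel x) n = x n"
proof -
  define e where "e m = complex_of_real (h (n + m))" for m
  have e: "e \<in> l2"
    unfolding e_def by (rule row_l2)
  have "hankel e m = (if n = m then 1 else 0)" for m
    using infsumI[OF orthonormal_complex[of m n]] by (auto simp: hankel_def e_def)
  then have "((\<lambda>m. x m * cnj (hankel e m)) has_sum x n) UNIV"
    by (intro has_sum_finite_neutralI[of "{n}"]) auto
  then have "l2_inner x (hankel e) = x n"
    unfolding l2_inner_def by (rule infsumI)
  moreover have "l2_inner (hankel x) e = hankel (hankel x) n"
    by (simp add: l2_inner_def hankel_def[of "hankel x"] e_def mult.commute)
  ultimately show ?thesis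
    using hankel_self_adjoint[OF x e] by simp
qed

lemma hankel_inner:
  assumes x: "x \<in> l2" and y: "y \<in> l2"
  shows "l2_inner (hankel x) (hankel y) = l2_inner x y"
proof -
  have "hankel (hankel y) = y"
    using hankel_involution[OF y] by auto
  then show ?thesis
    using hankel_self_adjoint[OF x hankel_l2[OF y]] by simp
qed

lemma bounded_of_l2:
  assumes "(g :: 'a \<Rightarrow> complex) \<in> l2"
  shows "cmod (g i) \<le> sqrt (l2_sq g)"
proof -
  have "(\<Sum>i\<in>{i}. (cmod (g i))\<^sup>2) \<le> l2_sq g"
    using assms unfolding l2_sq_def by (intro finite_sum_le_infsum) (auto simp: l2_def)
  then show ?thesis
    by (simp add: real_le_rsqrt)
qed

text \<open>The wavelet transform at scale \<open>q powi j\<close> in lattice coordinates: in the spectral domain a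
wavelet is a window \<open>g\<close>, shifted by \<open>j\<close>, through which the transform of \<open>x\<close> is seen.\<close>
definition band :: "(int \<Rightarrow> complex) \<Rightarrow> (int \<Rightarrow> complex) \<Rightarrow> int \<Rightarrow> int \<Rightarrow> complex" where
  "band g x j = hankel (\<lambda>t. hankel x t * cnj (g (j + t)))"

text \<open>At a fixed scale, unitarity of the Hankel operator returns the sum over all positions to the
spectral domain.\<close>
lemma band_inner_has_sum:
  assumes x: "x \<in> l2" and y: "y \<in> l2" and g: "g \<in> l2"
  shows "((\<lambda>n. band g x j n * cnj (band g y j n)) has_sum
           (\<Sum>\<^sub>\<infinity>t. (hankel x t * cnj (hankel y t)) * (cmod (g (j + t)))\<^sup>2)) UNIV"
proof -
  have m: "(\<lambda>t. hankel x t * cnj (g (j + t))) \<in> l2" if "x \<in> l2" for x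
    using bounded_of_l2[OF g] by (intro l2_mult_bounded hankel_l2 that) simp
  have "((\<lambda>n. band g x j n * cnj (band g y j n)) has_sum
          l2_inner (\<lambda>t. hankel x t * cnj (g (j + t))) (\<lambda>t. hankel y t * cnj (g (j + t)))) UNIV"
    unfolding band_def hankel_inner[OF m[OF x] m[OF y], symmetric]
    by (intro l2_inner_has_sum hankel_l2 m x y)
  moreover have "l2_inner (\<lambda>t. hankel x t * cnj (g (j + t))) (\<lambda>t. hankel y t * cnj (g (j + t)))
     = (\<Sum>\<^sub>\<infinity>t. (hankel x t * cnj (hankel y t)) * (cmod (g (j + t)))\<^sup>2)"
    unfolding l2_inner_def by (intro infsum_cong)
        (simp add: complex_norm_square mult_ac del: of_real_power)
  ultimately show ?thesis by simp
qed

text \<open>The substitution \<open>i = j + t\<close> separates the double series into a product.\<close>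
lemma band_double_has_sum:
  assumes x: "x \<in> l2" and y: "y \<in> l2" and g: "g \<in> l2"
  shows "((\<lambda>(j, t). (hankel x t * cnj (hankel y t)) * (cmod (g (j + t)))\<^sup>2) has_sum l2_inner x y
      * l2_sq g) UNIV"
proof -
  have "((\<lambda>(t, i). (hankel x t * cnj (hankel y t)) * complex_of_real ((cmod (g i))\<^sup>2))
      has_sum l2_inner x y * l2_sq g) UNIV"
  proof (rule has_sum_times)
    show "((\<lambda>t. hankel x t * cnj (hankel y t)) has_sum l2_inner x y) UNIV"
      using l2_inner_has_sum[OF hankel_l2[OF x] hankel_l2[OF y]] by (simp add: hankel_inner x y)
    show "((\<lambda>i. complex_of_real ((cmod (g i))\<^sup>2)) has_sum of_real (l2_sq g)) UNIV"
      by (intro has_sum_of_real l2_sq_has_sum g)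
    show "(\<lambda>t. norm (hankel x t * cnj (hankel y t))) summable_on UNIV"
      by (intro l2_abs_summable hankel_l2 x y)
    show "(\<lambda>i. norm (complex_of_real ((cmod (g i))\<^sup>2))) summable_on UNIV"
      using g by (simp add: l2_def norm_power)
  qed
  moreover have "bij_betw (\<lambda>(j, t). (t, j + t)) UNIV (UNIV :: (int \<times> int) set)"
    by (rule bij_betw_byWitness[of _ "\<lambda>(t, i). (i - t, t)"]) auto
  ultimately have "((\<lambda>z. case (case z of (j, t) \<Rightarrow> (t, j + t)) of (t, i) \<Rightarrow> (hankel x t
      * cnj (hankel y t)) * complex_of_real ((cmod (g i))\<^sup>2))
       has_sum l2_inner x y * l2_sq g) UNIV"
    by (subst has_sum_reindex_bij_betw)
  then show ?thesis
    by (simp add: case_prod_unfold)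
qed

lemma band_sq_summable:
  assumes x: "x \<in> l2" and g: "g \<in> l2"
  shows "(\<lambda>(j, n). (cmod (band g x j n))\<^sup>2) summable_on UNIV"
proof -
  define G where "G j = Re (\<Sum>\<^sub>\<infinity>t. (hankel x t * cnj (hankel x t)) * (cmod (g (j + t)))\<^sup>2)" for j
  have "(\<lambda>(j, n). (cmod (band g x j n))\<^sup>2) summable_on (SIGMA j:UNIV. UNIV)"
  proof (rule summable_on_SigmaI)
    show "((\<lambda>n. case (j, n) of (j, n) \<Rightarrow> (cmod (band g x j n))\<^sup>2) has_sum G j) UNIV" for j
      using has_sum_Re[OF band_inner_has_sum[OF x x g, of j]] unfolding G_def
      by (simp add: complex_mult_cnj cmod_power2)
    have "(\<lambda>(j, t). (hankel x t * cnj (hankel x t)) * (cmod (g (j + t)))\<^sup>2) summable_on (UNIV \<times> UNIV)"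
      using has_sum_imp_summable[OF band_double_has_sum[OF x x g]] by simp
    from summable_on_Re[OF summable_on_Sigma_banach[OF this]]
    show "G summable_on UNIV"
      by (simp add: G_def[abs_def])
  qed auto
  then show ?thesis by simp
qed

text \<open>The Parseval identity of the wavelet transform on \<open>\<ell>\<^sup>2(\<int>)\<close>. It is stated as an unconditional
double sum, so that it may be evaluated in either order; absolute convergence follows from the
case \<open>x = y\<close>, where all terms are nonnegative.\<close>
lemma band_has_sum:
  assumes x: "x \<in> l2" and y: "y \<in> l2" and g: "g \<in> l2"
  shows "((\<lambda>(j, n). band g x j n * cnj (band g y j n)) has_sum l2_inner x y * l2_sq g) UNIV"
proof -
  have "((\<lambda>(j, n). band g x j n * cnj (band g y j n)) has_sum l2_inner x y
      * l2_sq g) (SIGMA j:UNIV. UNIV)"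
  proof (rule has_sum_SigmaI)
    show "((\<lambda>n. case (j, n) of (j, n) \<Rightarrow> band g x j n * cnj (band g y j n)) has_sum
             (\<Sum>\<^sub>\<infinity>t. (hankel x t * cnj (hankel y t)) * (cmod (g (j + t)))\<^sup>2)) UNIV" for j
      using band_inner_has_sum[OF x y g, of j] by simp
    have d: "((\<lambda>(j, t). (hankel x t * cnj (hankel y t)) * (cmod (g (j + t)))\<^sup>2) has_sum l2_inner x y
        * l2_sq g) (SIGMA j:UNIV. UNIV)"
      using band_double_has_sum[OF x y g] by simp
    show "((\<lambda>j. \<Sum>\<^sub>\<infinity>t. (hankel x t * cnj (hankel y t)) * (cmod (g (j + t)))\<^sup>2) has_sum l2_inner x y
        * l2_sq g) UNIV"
    proof (rule has_sum_SigmaD[OF d])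
      fix j
      have "(\<lambda>t. (hankel x t * cnj (hankel y t)) * (cmod (g (j + t)))\<^sup>2) summable_on UNIV"
        using summable_on_SigmaD1[OF has_sum_imp_summable[OF d], of j] by simp
      then show "((\<lambda>t. case (j, t) of (j, t) \<Rightarrow> (hankel x t * cnj (hankel y t))
          * (cmod (g (j + t)))\<^sup>2) has_sum
         (\<Sum>\<^sub>\<infinity>t. (hankel x t * cnj (hankel y t)) * (cmod (g (j + t)))\<^sup>2)) UNIV"
        by simp
    qed
    have "(\<lambda>z. norm (case z of (j, n) \<Rightarrow> band g x j n * cnj (band g y j n))) summable_on UNIV"
    proof (rule Infinite_Sum.abs_summable_on_comparison_test')
      show "(\<lambda>z. (case z of (j, n) \<Rightarrow> (cmod (band g x j n))\<^sup>2)
          + (case z of (j, n) \<Rightarrow> (cmod (band g y j n))\<^sup>2)) summable_on UNIV"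
        by (intro summable_on_add band_sq_summable x y g)
    qed (auto intro: l2_prod_le)
    then show "(\<lambda>(j, n). band g x j n * cnj (band g y j n)) summable_on (SIGMA j:UNIV. UNIV)"
      using abs_summable_summable by simp
  qed
  then show ?thesis by simp
qed

end

section \<open>The q-Bessel Fourier transform in lattice coordinates\<close>

lemma powi_powr:
  assumes "0 < (x::real)"
  shows "(x powi n) powr a = (x powr a) powi n"
proof -
  have "(x powi n) powr a = (x powr real_of_int n) powr a"
    using assms by (simp add: powr_real_of_int')
  also have "\<dots> = (x powr a) powr real_of_int n"
    by (simp add: powr_powr mult.commute)
  also have "\<dots> = (x powr a) powi n"
    using assms by (simp add: powr_real_of_int')
  finally show ?thesis .
qed

text \<open>The integer \<open>s\<close> is \<open>ln (1 - q) / ln q\<close>.\<close>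
locale q_bessel =
  fixes q \<alpha> :: real and s :: int
  assumes q: "0 < q" "q < 1" and s: "1 - q = q powi s" and alpha: "\<alpha> > - 1 / 2"
begin

definition v :: real where "v = q powr (\<alpha> + 1)"

definition \<kappa> :: real where "\<kappa> = q powr (2 * \<alpha> + 1)"

text \<open>The shift by \<open>s - 1\<close> comes from the argument \<open>(1 - q) * x / q\<close> at which the normalized
\<open>q\<close>-Bessel function evaluates the Hahn-Exton function: multiplication by \<open>1 - q\<close> is a shift by
\<open>s\<close>, division by \<open>q\<close> a shift by \<open>-1\<close>.\<close>
definition lattice_kernel :: "int \<Rightarrow> real" where "lattice_kernel k = bessel_kernel (q\<^sup>2) v (k + s - 1)"

text \<open>The values of the \<open>q\<close>-Bessel function on the lattice, see \<open>bessel_j3_lattice\<close>.\<close>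
definition lattice_bessel :: "int \<Rightarrow> real" where
  "lattice_bessel k = q_pochhammer_inf (q\<^sup>2) (q\<^sup>2) / q_pochhammer_inf (v\<^sup>2) (q\<^sup>2)
      * bessel_seq (q\<^sup>2) (v\<^sup>2) (k + s - 1)"

lemma v_bounds: "0 < v" "v < 1"
proof -
  show "0 < v" using q by (simp add: v_def)
  show "v < 1" unfolding v_def using q alpha powr_less_mono'[of q 0 "\<alpha> + 1"] by simp
qed

lemma q_sq_bounds: "0 < q\<^sup>2" "q\<^sup>2 < 1"
  using q by (auto simp: power_less_one_iff)

lemma v_sq_bounds: "0 < v\<^sup>2" "v\<^sup>2 < 1"
  using v_bounds by (auto simp: power_less_one_iff)

lemma v_sq: "v\<^sup>2 = q powr (2 * \<alpha> + 2)"
proof -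
  have "2 * (\<alpha> + 1) = 2 * \<alpha> + 2" by simp
  then show ?thesis
    using q by (simp add: v_def powr_powr mult.commute flip: powr_numeral)
qed

lemma kappa_pos: "0 < \<kappa>"
  using q by (simp add: \<kappa>_def)

sublocale hankel_unitary lattice_kernel
proof
  fix n m
  have "((\<lambda>k. bessel_kernel (q\<^sup>2) v ((n + s - 1) + k) * bessel_kernel (q\<^sup>2) v ((m + s - 1) + k))
          has_sum (if n + s - 1 = m + s - 1 then 1 else 0)) UNIV"
    by (intro bessel_kernel_orthonormal q_sq_bounds v_bounds)
  then show "((\<lambda>k. lattice_kernel (n + k) * lattice_kernel (m + k))
      has_sum (if n = m then 1 else 0)) UNIV"
    by (simp add: lattice_kernel_def algebra_simps split: if_splits)
qed

lemma bessel_j3_lattice: "q_bessel_j3 q \<alpha> (of_real (q powi k)) = of_real (lattice_bessel k)"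
proof -
  have "(\<lambda>n. (-1) ^ n * (q\<^sup>2) ^ (n choose 2)
      / (q_pochhammer (q\<^sup>2) (q\<^sup>2) n * q_pochhammer (v\<^sup>2) (q\<^sup>2) n) * ((q\<^sup>2) powi (k + s)) ^ n)
          sums lattice_bessel k"
    using bessel_seq_series[OF q_sq_bounds v_sq_bounds, of "k + s - 1"]
        by (simp add: lattice_bessel_def)
  then have "(\<lambda>n. complex_of_real ((-1) ^ n * (q\<^sup>2) ^ (n choose 2)
      / (q_pochhammer (q\<^sup>2) (q\<^sup>2) n * q_pochhammer (v\<^sup>2) (q\<^sup>2) n) * ((q\<^sup>2) powi (k + s)) ^ n)) sums
          of_real (lattice_bessel k)"
    by (rule sums_of_real)
  moreover have "of_real ((-1) ^ n * q ^ (n * (n - 1)) * (1 - q) ^ (2 * n)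
              / (q_pochhammer (q\<^sup>2) (q\<^sup>2) n * q_pochhammer (q powr (2 * \<alpha> + 2)) (q\<^sup>2) n))
            * complex_of_real (q powi k) ^ (2 * n)
     = complex_of_real ((-1) ^ n * (q\<^sup>2) ^ (n choose 2)
         / (q_pochhammer (q\<^sup>2) (q\<^sup>2) n * q_pochhammer (v\<^sup>2) (q\<^sup>2) n)
             * ((q\<^sup>2) powi (k + s)) ^ n)" for n
  proof -
    have "2 * (n choose 2) = n * (n - 1)"
      by (cases n) (simp_all add: choose_two)
    then have 1: "q ^ (n * (n - 1)) = (q\<^sup>2) ^ (n choose 2)"
      by (simp flip: power_mult)
    have "(q\<^sup>2) powi (k + s) = (1 - q)\<^sup>2 * (q powi k)\<^sup>2"
      using q unfolding s by (simp add: power_int_add power2_eq_square power_int_mult_distrib)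
    then have 2: "((q\<^sup>2) powi (k + s)) ^ n = (1 - q) ^ (2 * n) * (q powi k) ^ (2 * n)"
      by (simp add: power_mult_distrib flip: power_mult)
    show ?thesis
      unfolding 1 2 v_sq[symmetric] by simp
  qed
  ultimately show ?thesis
    unfolding q_bessel_j3_def by (auto simp: sums_iff)
qed

text \<open>Boundedness keeps \<open>\<ell>\<^sup>2\<close> stable under multiplication by the Bessel function, which is how
translations act in the spectral domain.\<close>
lemma lattice_bessel_bounded: "\<exists>B. \<forall>k. \<bar>lattice_bessel k\<bar> \<le> B"
proof -
  have "\<bar>lattice_bessel k\<bar> \<le> \<bar>q_pochhammer_inf (q\<^sup>2) (q\<^sup>2) / q_pochhammer_inf (v\<^sup>2) (q\<^sup>2)\<bar> *
       (1 / q_pochhammer_inf (q\<^sup>2) (q\<^sup>2) * (\<Sum>\<^sub>\<infinity>i. \<bar>euler_int (q\<^sup>2) i * (v\<^sup>2) powi i\<bar>))" for k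
    unfolding lattice_bessel_def abs_mult[of "_ / _"]
    by (intro mult_left_mono bessel_seq_bound q_sq_bounds) simp
  then show ?thesis by blast
qed

text \<open>The normalizing constant of the Fourier transform, the two infinite products in
\<open>lattice_bessel\<close> and the weights combine to \<open>\<kappa>\<close> times the orthonormal kernel. Both sides contain
\<open>(1 - q) powr (\<alpha> + 1)\<close>, which is \<open>v powi s\<close>.\<close>
lemma kernel_eq: "q_bessel_const q \<alpha> * (1 - q) * v powi k * lattice_bessel k = \<kappa> * lattice_kernel k"
proof -
  define P where "P = q_pochhammer_inf (q\<^sup>2) (q\<^sup>2)"
  define W where "W = q_pochhammer_inf (v\<^sup>2) (q\<^sup>2)"
  have PW: "0 < P" "0 < W"
    using q_sq_bounds v_sq_bounds by (auto simp: P_def W_def intro!: q_pochhammer_inf_pos)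
  have "(q\<^sup>2) powr (\<alpha> + 1) = v\<^sup>2"
    using q by (simp add: v_def powr_powr mult.commute flip: powr_numeral)
  then have G: "q_Gamma (q\<^sup>2) (\<alpha> + 1) = P / W * (1 - q\<^sup>2) powr (- \<alpha>)"
    by (simp add: q_Gamma_def P_def W_def)
  have "1 + inverse q = (1 + q) / q" "1 - q\<^sup>2 = (1 + q) * (1 - q)"
    using q by (auto simp: field_simps power2_eq_square)
  then have "(1 + inverse q) powr (- \<alpha>) / (1 - q\<^sup>2) powr (- \<alpha>) = q powr \<alpha> * (1 - q) powr \<alpha>"
    using q powr_mult[of "1 + q" "1 - q" \<alpha>] by (simp add: powr_divide powr_minus field_simps)
  note powers = this
  have "q_bessel_const q \<alpha> = (1 + inverse q) powr (- \<alpha>) / (1 - q\<^sup>2) powr (- \<alpha>) * W / P"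
    by (simp add: q_bessel_const_def G)
  then have "q_bessel_const q \<alpha> = q powr \<alpha> * (1 - q) powr \<alpha> * W / P"
    unfolding powers .
  moreover have "(1 - q) powr \<alpha> * (1 - q) = v powi s"
  proof -
    have "(1 - q) powr \<alpha> * (1 - q) = (1 - q) powr (\<alpha> + 1)"
      using q by (simp add: powr_add)
    also have "\<dots> = v powi s"
      unfolding s v_def by (rule powi_powr) (rule q)
    finally show ?thesis .
  qed
  ultimately have "q_bessel_const q \<alpha> * (1 - q) = q powr \<alpha> * v powi s * W / P"
    by (simp add: mult_ac)
  moreover have "\<kappa> * v powi (k + s - 1) = q powr \<alpha> * v powi s * v powi k"
  proof -
    have "v powi (k + s) = v powi (k + s - 1) * v"
      using v_bounds by (simp add: power_int_diff)
    moreover have "\<kappa> = q powr \<alpha> * v"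
      using q by (simp add: \<kappa>_def v_def flip: powr_add)
    ultimately show ?thesis
      using v_bounds by (simp add: power_int_add mult_ac)
  qed
  ultimately show ?thesis
    using PW unfolding lattice_bessel_def lattice_kernel_def bessel_kernel_def P_def[symmetric]
        W_def[symmetric] by simp
qed

text \<open>The weight \<open>v powi n\<close> is the square root of \<open>q powi n * (q powi n) powr (2 * \<alpha> + 1)\<close>, the
mass of the lattice point for the measure \<open>x powr (2 * \<alpha> + 1) d\<^sub>q x\<close> without the factor \<open>1 - q\<close>;
it makes \<open>coeffs\<close> an isometry onto \<open>\<ell>\<^sup>2(\<int>)\<close> up to that factor.\<close>
definition coeffs :: "(real \<Rightarrow> complex) \<Rightarrow> int \<Rightarrow> complex" where
  "coeffs f n = f (q powi n) * of_real (v powi n)"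

lemma lattice_weight: "q powi n * (q powi n) powr (2 * \<alpha> + 1) = (v powi n)\<^sup>2"
proof -
  have "q powi n * (q powi n) powr (2 * \<alpha> + 1) = (q powi n) powr (2 * \<alpha> + 2)"
    using q powr_add[of "q powi n" 1 "2 * \<alpha> + 1"] by (simp add: algebra_simps)
  also have "\<dots> = (v\<^sup>2) powi n"
    unfolding v_sq by (rule powi_powr) (rule q)
  finally show ?thesis
    by (simp add: power2_eq_square power_int_mult_distrib)
qed

lemma lattice_weight_complex:
  "q powi n *\<^sub>R (z * complex_of_real ((q powi n) powr (2 * \<alpha> + 1))) = z * (of_real (v powi n))\<^sup>2"
proof -
  have "q powi n *\<^sub>R (z * complex_of_real ((q powi n) powr (2 * \<alpha> + 1)))
      = z * of_real (q powi n * (q powi n) powr (2 * \<alpha> + 1))"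
    by (simp add: scaleR_conv_of_real)
  then show ?thesis
    unfolding lattice_weight by simp
qed

lemma L2_norm_term:
  "q powi n *\<^sub>R ((cmod (f (q powi n)))\<^sup>2 * (q powi n) powr (2 * \<alpha> + 1)) = (cmod (coeffs f n))\<^sup>2"
proof -
  have "q powi n *\<^sub>R ((cmod (f (q powi n)))\<^sup>2 * (q powi n) powr (2 * \<alpha> + 1))
      = (cmod (f (q powi n)))\<^sup>2 * (v powi n)\<^sup>2"
    unfolding lattice_weight[symmetric] by simp
  then show ?thesis
    using v_bounds by (simp add: coeffs_def norm_mult power_mult_distrib norm_power_int)
qed

lemma q_L2_iff: "f \<in> q_L2 q \<alpha> \<longleftrightarrow> coeffs f \<in> l2"
  by (simp add: q_L2_def q_integrable_def l2_def L2_norm_term del: real_scaleR_def)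

lemma q_L2_norm_sq: "(q_L2_norm q \<alpha> f)\<^sup>2 = (1 - q) * l2_sq (coeffs f)"
proof -
  have "0 \<le> l2_sq (coeffs f)"
    by (simp add: l2_sq_def infsum_nonneg)
  moreover have "q_integral q (\<lambda>x. (cmod (f x))\<^sup>2 * x powr (2 * \<alpha> + 1)) = (1 - q) * l2_sq (coeffs f)"
    unfolding q_integral_def L2_norm_term l2_sq_def by simp
  ultimately show ?thesis
    using q by (simp add: q_L2_norm_def)
qed

lemma fourier_lattice:
  "of_real (v powi n) * q_fourier q \<alpha> f (q powi n) = of_real \<kappa> * hankel (coeffs f) n"
proof -
  define c where "c = complex_of_real (q_bessel_const q \<alpha> * (1 - q) * v powi n)"
  have "of_real (v powi n) * q_fourier q \<alpha> f (q powi n)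
     = c * (\<Sum>\<^sub>\<infinity>m. q powi m *\<^sub>R (f (q powi m) * q_bessel_j3 q \<alpha> (of_real (q powi n * q powi m))
         * of_real ((q powi m) powr (2 * \<alpha> + 1))))"
    by (simp add: q_fourier_def q_integral_def c_def scaleR_conv_of_real)
  also have "\<dots> = (\<Sum>\<^sub>\<infinity>m. c * (f (q powi m) * of_real (lattice_bessel (n + m))
      * (of_real (v powi m))\<^sup>2))"
  proof -
    have "q powi n * q powi m = q powi (n + m)" for m
      using q by (simp add: power_int_add)
    then show ?thesis
      by (simp only: lattice_weight_complex infsum_cmult_right' bessel_j3_lattice)
  qed
  also have "\<dots> = (\<Sum>\<^sub>\<infinity>m. of_real \<kappa> * (of_real (lattice_kernel (n + m)) * coeffs f m))"
  proof (rule infsum_cong)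
    fix m
    have "c * (f (q powi m) * of_real (lattice_bessel (n + m)) * (of_real (v powi m))\<^sup>2)
      = of_real (q_bessel_const q \<alpha> * (1 - q) * v powi (n + m) * lattice_bessel (n + m)) * coeffs f m"
      using v_bounds by (simp add: c_def coeffs_def power_int_add power2_eq_square mult_ac)
    also have "\<dots> = of_real \<kappa> * (of_real (lattice_kernel (n + m)) * coeffs f m)"
      unfolding kernel_eq by simp
    finally show "c * (f (q powi m) * of_real (lattice_bessel (n + m)) * (of_real (v powi m))\<^sup>2)
        = of_real \<kappa> * (of_real (lattice_kernel (n + m)) * coeffs f m)" .
  qed
  also have "\<dots> = of_real \<kappa> * hankel (coeffs f) n"
    by (simp add: hankel_def infsum_cmult_right')
  finally show ?thesis .
qed

lemma lattice_inj: "inj (\<lambda>n::int. q powi n)"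
proof (rule injI)
  fix m n :: int assume "q powi m = q powi n"
  then show "m = n"
    using q power_int_strict_decreasing[of m n q] power_int_strict_decreasing[of n m q]
    by (cases m n rule: linorder_cases) auto
qed

lemma coeffs_surj: "\<exists>h. coeffs h = x \<and> (\<forall>y. h (- y) = h y) \<and> (\<forall>y. \<bar>y\<bar> \<notin> q_lattice q \<longrightarrow> h y = 0)"
proof -
  define e where "e = inv (\<lambda>n::int. q powi n)"
  have e: "e (q powi n) = n" for n
    unfolding e_def by (rule inv_f_f[OF lattice_inj])
  define h where "h y = (if \<bar>y\<bar> \<in> q_lattice q then x (e \<bar>y\<bar>) / of_real (v powi e \<bar>y\<bar>) else 0)" for y
  have "coeffs h n = x n" for n
    using q v_bounds by (simp add: coeffs_def h_def e q_lattice_def)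
  then have "coeffs h = x" by auto
  then show ?thesis
    by (intro exI[of _ h]) (auto simp: h_def)
qed

lemma coeffs_eqD:
  assumes "coeffs h = coeffs h'"
    and "\<forall>y. h (- y) = h y" "\<forall>y. \<bar>y\<bar> \<notin> q_lattice q \<longrightarrow> h y = 0"
    and "\<forall>y. h' (- y) = h' y" "\<forall>y. \<bar>y\<bar> \<notin> q_lattice q \<longrightarrow> h' y = 0"
  shows "h = h'"
proof
  fix y
  have *: "h (q powi n) = h' (q powi n)" for n
    using fun_cong[OF assms(1), of n] v_bounds by (simp add: coeffs_def)
  show "h y = h' y"
  proof (cases "\<bar>y\<bar> \<in> q_lattice q")
    case True
    then have "h \<bar>y\<bar> = h' \<bar>y\<bar>"
      using * by (auto simp: q_lattice_def)
    then show ?thesis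
      using assms(2,4) by (cases "y \<ge> 0") auto
  qed (use assms in auto)
qed

text \<open>Inversion of the Fourier transform turns the implicit description of the translate into a
formula, and with it gives both its existence and its uniqueness: the condition on \<open>h\<close> is \<open>hankel
(coeffs h) = y\<close> with \<open>y \<in> l2\<close>, whose only solution is \<open>coeffs h = hankel y\<close>, and evenness and the
values off the lattice determine \<open>h\<close> from its coefficients.\<close>
lemma translation_coeffs:
  assumes g: "coeffs g \<in> l2"
  shows "coeffs (q_translation q \<alpha> (q powi n) g)
      = hankel (\<lambda>t. hankel (coeffs g) t * of_real (lattice_bessel (n + t)))"
proof -
  define y where "y t = hankel (coeffs g) t * complex_of_real (lattice_bessel (n + t))" for t
  define P where "P h \<longleftrightarrow> h \<in> q_L2 q \<alpha> \<and> (\<forall>y. h (- y) = h y) \<and> (\<forall>y. \<bar>y\<bar> \<notin> q_lattice q \<longrightarrow> h y = 0) \<and>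
        (\<forall>t\<in>q_lattice q.
           q_fourier q \<alpha> h t = q_bessel_j3 q \<alpha> (of_real (t * q powi n)) * q_fourier q \<alpha> g t)" for h
  obtain B where "\<And>k. \<bar>lattice_bessel k\<bar> \<le> B"
    using lattice_bessel_bounded by blast
  then have y: "y \<in> l2"
    unfolding y_def by (intro l2_mult_bounded[of _ _ B] hankel_l2 g) simp
  have fourier_iff: "(\<forall>t\<in>q_lattice q. q_fourier q \<alpha> h t = q_bessel_j3 q \<alpha> (of_real (t * q powi n))
      * q_fourier q \<alpha> g t)
        \<longleftrightarrow> hankel (coeffs h) = y" for h
  proof -
    have "q_fourier q \<alpha> h (q powi m) = q_bessel_j3 q \<alpha> (of_real (q powi m * q powi n))
        * q_fourier q \<alpha> g (q powi m)
       \<longleftrightarrow> hankel (coeffs h) m = y m" for m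
    proof -
      have "q powi m * q powi n = q powi (n + m)"
        using q by (simp add: power_int_add)
      then have j: "q_bessel_j3 q \<alpha> (of_real (q powi m * q powi n))
          = of_real (lattice_bessel (n + m))"
        by (simp only: bessel_j3_lattice)
      have vk: "complex_of_real (v powi m) \<noteq> 0" "complex_of_real \<kappa> \<noteq> 0"
        using v_bounds kappa_pos by auto
      have "q_fourier q \<alpha> h (q powi m) = of_real (lattice_bessel (n + m)) * q_fourier q \<alpha> g (q powi m)
        \<longleftrightarrow> of_real (v powi m) * q_fourier q \<alpha> h (q powi m) = of_real (lattice_bessel (n + m))
            * (of_real (v powi m) * q_fourier q \<alpha> g (q powi m))"
        using v_bounds by (simp add: mult.left_commute)
      also have "\<dots> \<longleftrightarrow> of_real \<kappa> * hankel (coeffs h) m = of_real \<kappa> * y m"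
        unfolding fourier_lattice y_def by (simp only: mult_ac)
      also have "\<dots> \<longleftrightarrow> hankel (coeffs h) m = y m"
        using vk by simp
      finally show ?thesis unfolding j .
    qed
    then show ?thesis
      by (auto simp: q_lattice_def fun_eq_iff)
  qed
  have P: "P h \<longleftrightarrow> coeffs h \<in> l2 \<and> (\<forall>y. h (- y) = h y) \<and> (\<forall>y. \<bar>y\<bar> \<notin> q_lattice q \<longrightarrow> h y = 0) \<and> hankel
      (coeffs h) = y" for h
    unfolding P_def fourier_iff q_L2_iff ..
  have coeffs: "coeffs h = hankel y" if "P h" for h
  proof
    fix m
    have "coeffs h \<in> l2" "hankel (coeffs h) = y"
      using that by (auto simp: P)
    then show "coeffs h m = hankel y m"
      using hankel_involution by metis
  qed
  obtain h0 where h0: "coeffs h0 = hankel y" "\<forall>y. h0 (- y) = h0 y" "\<forall>y. \<bar>y\<bar> \<notin> q_lattice q \<longrightarrow> h0 y = 0"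
    using coeffs_surj by metis
  have "hankel (hankel y) = y"
    using hankel_involution[OF y] by auto
  then have "P h0"
    unfolding P h0(1) using h0 hankel_l2[OF y] by simp
  moreover have "h = h0" if "P h" for h
    using that h0 coeffs[OF that] by (intro coeffs_eqD) (auto simp: P)
  ultimately have "P (THE h. P h)"
    by (rule theI)
  then have "coeffs (THE h. P h) = hankel y"
    by (rule coeffs)
  then show ?thesis
    by (simp add: q_translation_def P_def[abs_def] y_def[abs_def])
qed

lemma dilation_coeffs: "coeffs (q_dilation \<alpha> (q powi j) g) n = of_real (v powi (- j))
    * coeffs g (n - j)"
proof -
  have "- 2 * \<alpha> - 2 = - (2 * \<alpha> + 2)" by simp
  then have "(q powi j) powr (- 2 * \<alpha> - 2) = (v\<^sup>2) powi (- j)"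
    unfolding v_sq using powi_powr[OF q(1), of j "2 * \<alpha> + 2"] q
    by (simp only: powr_minus power_int_minus)
  then have "(q powi j) powr (- 2 * \<alpha> - 2) * v powi n = v powi (- j) * v powi (n - j)"
    using v_bounds by (simp add: power2_eq_square power_int_mult_distrib power_int_minus
        power_int_diff field_simps)
  moreover have "q powi n / q powi j = q powi (n - j)"
    using q by (simp add: power_int_diff)
  ultimately show ?thesis
    by (simp add: coeffs_def q_dilation_def mult_ac del: of_real_power_int flip: of_real_mult)
qed

lemma shift_bij: "bij_betw (\<lambda>n::int. n - j) UNIV UNIV"
  by (rule bij_betw_byWitness[of _ "\<lambda>n. n + j"]) auto

lemma dilation_l2:
  assumes "coeffs g \<in> l2"
  shows "coeffs (q_dilation \<alpha> (q powi j) g) \<in> l2"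
proof -
  have "(\<lambda>n. (v powi (- j))\<^sup>2 * (cmod (coeffs g (n - j)))\<^sup>2) summable_on UNIV"
    using assms summable_on_reindex_bij_betw[OF shift_bij[of j], of "\<lambda>n. (cmod (coeffs g n))\<^sup>2"]
    by (intro summable_on_cmult_right) (simp add: l2_def)
  then show ?thesis
    using v_bounds by (simp add: l2_def dilation_coeffs norm_mult power_mult_distrib
        del: power_int_minus of_real_power_int)
qed

lemma dilation_hankel:
  "hankel (coeffs (q_dilation \<alpha> (q powi j) g)) t = of_real (v powi (- j)) * hankel (coeffs g) (j + t)"
proof -
  have "hankel (coeffs (q_dilation \<alpha> (q powi j) g)) t
     = of_real (v powi (- j)) * (\<Sum>\<^sub>\<infinity>m. of_real (lattice_kernel (j + t + (m - j))) * coeffs g (m - j))"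
    unfolding hankel_def dilation_coeffs infsum_cmult_right'[symmetric]
    by (intro infsum_cong) (simp add: add.commute mult_ac)
  also have "(\<Sum>\<^sub>\<infinity>m. of_real (lattice_kernel (j + t + (m - j))) * coeffs g (m - j))
      = hankel (coeffs g) (j + t)"
    unfolding hankel_def by (rule infsum_reindex_bij_betw[OF shift_bij])
  finally show ?thesis .
qed

text \<open>The transform of the atom at scale \<open>q powi j\<close> and position \<open>q powi n\<close> is the Bessel function
times a dilate of the transform of \<open>g\<close>. Moving the Hankel operator from the atom to \<open>f\<close> therefore
leaves a sum against the Bessel function in the variable \<open>n + t\<close>, and this is again a Hankel
transform.\<close>
lemma wavelet_transform_lattice:
  assumes f: "coeffs f \<in> l2" and g: "coeffs g \<in> l2"
  shows "wavelet_transform q \<alpha> g f (q powi j) (q powi n) * of_real (v powi n)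
     = of_real (sqrt (q powi j)) * band (\<lambda>i. q_fourier q \<alpha> g (q powi i)) (coeffs f) j n"
proof -
  define \<gamma> where "\<gamma> i = q_fourier q \<alpha> g (q powi i)" for i
  define r where "r = complex_of_real (sqrt (q powi j))"
  define c where "c = complex_of_real (q_bessel_const q \<alpha> * (1 - q) * v powi n)"
  define \<tau> where "\<tau> = coeffs (q_translation q \<alpha> (q powi n) (q_dilation \<alpha> (q powi j) g))"
  define \<sigma> where "\<sigma> t = hankel (coeffs (q_dilation \<alpha> (q powi j) g)) t
      * complex_of_real (lattice_bessel (n + t))" for t
  have \<tau>: "\<tau> = hankel \<sigma>"
    unfolding \<tau>_def \<sigma>_def by (rule translation_coeffs[OF dilation_l2[OF g]])
  obtain B where "\<And>k. \<bar>lattice_bessel k\<bar> \<le> B"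
    using lattice_bessel_bounded by blast
  then have \<sigma>_l2: "\<sigma> \<in> l2"
    unfolding \<sigma>_def by (intro l2_mult_bounded[of _ _ B] hankel_l2 dilation_l2 g) simp
  have \<sigma>: "\<sigma> t = of_real (v powi t * lattice_bessel (n + t) / \<kappa>) * \<gamma> (j + t)" for t
  proof -
    have "hankel (coeffs g) (j + t) = of_real (v powi (j + t)) * \<gamma> (j + t) / of_real \<kappa>"
      using fourier_lattice[of "j + t" g] kappa_pos by (simp add: \<gamma>_def field_simps)
    then show ?thesis
      using v_bounds by (simp add: \<sigma>_def dilation_hankel power_int_add power_int_minus)
  qed
  have "wavelet_transform q \<alpha> g f (q powi j) (q powi n) * of_real (v powi n)
      = c * (\<Sum>\<^sub>\<infinity>m. q powi m *\<^sub>R (f (q powi m)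
          * cnj (wavelet_atom q \<alpha> g (q powi j) (q powi n) (q powi m))
              * of_real ((q powi m) powr (2 * \<alpha> + 1))))"
    by (simp add: wavelet_transform_def q_integral_def c_def scaleR_conv_of_real)
  also have "\<dots> = c * (\<Sum>\<^sub>\<infinity>m. r * (coeffs f m * cnj (\<tau> m)))"
    unfolding lattice_weight_complex
    by (intro arg_cong[of _ _ "(*) c"] infsum_cong)
       (simp add: wavelet_atom_def r_def \<tau>_def coeffs_def power2_eq_square mult_ac)
  also have "\<dots> = c * r * l2_inner (coeffs f) \<tau>"
    by (simp add: infsum_cmult_right' l2_inner_def)
  also have "\<dots> = c * r * l2_inner (hankel (coeffs f)) \<sigma>"
    unfolding \<tau> hankel_self_adjoint[OF f \<sigma>_l2] ..
  also have "\<dots> = r * (\<Sum>\<^sub>\<infinity>t. c * (hankel (coeffs f) t * cnj (\<sigma> t)))"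
    by (simp add: infsum_cmult_right' l2_inner_def)
  also have "\<dots> = r * (\<Sum>\<^sub>\<infinity>t. of_real (lattice_kernel (n + t))
      * (hankel (coeffs f) t * cnj (\<gamma> (j + t))))"
  proof (intro arg_cong[of _ _ "(*) r"] infsum_cong)
    fix t
    have "c * (hankel (coeffs f) t * cnj (\<sigma> t))
        = of_real (q_bessel_const q \<alpha> * (1 - q) * v powi (n + t) * lattice_bessel (n + t) / \<kappa>)
            * (hankel (coeffs f) t * cnj (\<gamma> (j + t)))"
      using v_bounds by (simp add: c_def \<sigma> power_int_add)
    then show "c * (hankel (coeffs f) t * cnj (\<sigma> t)) = of_real (lattice_kernel (n + t))
        * (hankel (coeffs f) t * cnj (\<gamma> (j + t)))"
      unfolding kernel_eq using kappa_pos by simp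
  qed
  finally show ?thesis
    by (simp only: band_def hankel_def[of "\<lambda>t. hankel (coeffs f) t * cnj (\<gamma> (j + t))"]
        r_def[symmetric] \<gamma>_def[symmetric])
qed

end

section \<open>Plancherel and Parseval formulas for the wavelet transform\<close>

lemma q_integral_iterated:
  fixes F :: "real \<Rightarrow> real \<Rightarrow> 'a::real_normed_vector"
  shows "q_integral q (\<lambda>x. q_integral q (F x))
       = (1 - q)\<^sup>2 *\<^sub>R (\<Sum>\<^sub>\<infinity>m. \<Sum>\<^sub>\<infinity>n. (q powi m * q powi n) *\<^sub>R F (q powi m) (q powi n))"
proof -
  have "q powi m *\<^sub>R (1 - q) *\<^sub>R (\<Sum>\<^sub>\<infinity>n. q powi n *\<^sub>R F (q powi m) (q powi n))
      = (1 - q) *\<^sub>R (\<Sum>\<^sub>\<infinity>n. (q powi m * q powi n) *\<^sub>R F (q powi m) (q powi n))" for m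
    unfolding infsum_scaleR_right[symmetric] by (simp add: mult_ac)
  then show ?thesis
    unfolding q_integral_def by (simp add: power2_eq_square infsum_scaleR_right)
qed

context q_bessel
begin

text \<open>The factor \<open>sqrt a\<close> in each of the two atoms, the factor \<open>a\<close> from the Jackson integral and
the weight \<open>1 / a\<^sup>2\<close> cancel, and the weight in \<open>b\<close> is the square of \<open>v powi n\<close>.\<close>
lemma wavelet_product_lattice:
  fixes f1 f2 g :: "real \<Rightarrow> complex"
  defines "\<gamma> \<equiv> \<lambda>i. q_fourier q \<alpha> g (q powi i)"
  assumes f1: "coeffs f1 \<in> l2" and f2: "coeffs f2 \<in> l2" and g: "coeffs g \<in> l2"
  shows "(q powi j * q powi n) *\<^sub>R (wavelet_transform q \<alpha> g f1 (q powi j) (q powi n)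
            * cnj (wavelet_transform q \<alpha> g f2 (q powi j) (q powi n))
            * of_real ((q powi n) powr (2 * \<alpha> + 1) / (q powi j)\<^sup>2))
         = band \<gamma> (coeffs f1) j n * cnj (band \<gamma> (coeffs f2) j n)"
proof -
  define A where "A = wavelet_transform q \<alpha> g f1 (q powi j) (q powi n)"
  define B where "B = wavelet_transform q \<alpha> g f2 (q powi j) (q powi n)"
  define r where "r = complex_of_real (sqrt (q powi j))"
  define u where "u = complex_of_real (v powi n)"
  have r: "r * r = of_real (q powi j)" "cnj r = r" "r \<noteq> 0"
    using q by (simp_all add: r_def flip: of_real_mult del: of_real_power_int)
  have A: "A * u = r * band \<gamma> (coeffs f1) j n" and B: "B * u = r * band \<gamma> (coeffs f2) j n"
    unfolding A_def B_def r_def u_def \<gamma>_def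
        by (rule wavelet_transform_lattice[OF f1 g] wavelet_transform_lattice[OF f2 g])+
  have "q powi j * q powi n * ((q powi n) powr (2 * \<alpha> + 1) / (q powi j)\<^sup>2) = (v powi n)\<^sup>2 / q powi j"
    unfolding lattice_weight[symmetric] using q by (simp add: power2_eq_square)
  then have "(q powi j * q powi n) *\<^sub>R (A * cnj B
      * of_real ((q powi n) powr (2 * \<alpha> + 1) / (q powi j)\<^sup>2))
      = A * cnj B * of_real ((v powi n)\<^sup>2 / q powi j)"
    by (simp add: scaleR_conv_of_real mult_ac del: of_real_power_int flip: of_real_mult
        of_real_divide)
  also have "\<dots> = (A * u) * cnj (B * u) / (r * r)"
    unfolding r by (simp add: u_def power2_eq_square)
  also have "\<dots> = band \<gamma> (coeffs f1) j n * cnj (band \<gamma> (coeffs f2) j n)"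
    unfolding A B complex_cnj_mult r(2) using r(3) by simp
  finally show ?thesis
    by (simp add: A_def B_def)
qed

lemma wavelet_square_lattice:
  fixes f g :: "real \<Rightarrow> complex"
  defines "\<gamma> \<equiv> \<lambda>i. q_fourier q \<alpha> g (q powi i)"
  assumes f: "coeffs f \<in> l2" and g: "coeffs g \<in> l2"
  shows "(q powi j * q powi n) *\<^sub>R ((cmod (wavelet_transform q \<alpha> g f (q powi j) (q powi n)))\<^sup>2
            * (q powi n) powr (2 * \<alpha> + 1) / (q powi j)\<^sup>2)
         = (cmod (band \<gamma> (coeffs f) j n))\<^sup>2"
proof -
  have "complex_of_real ((q powi j * q powi n) *\<^sub>R
      ((cmod (wavelet_transform q \<alpha> g f (q powi j) (q powi n)))\<^sup>2
            * (q powi n) powr (2 * \<alpha> + 1) / (q powi j)\<^sup>2))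
                = of_real ((cmod (band \<gamma> (coeffs f) j n))\<^sup>2)"
    using wavelet_product_lattice[OF f f g, of j n]
    by (simp add: \<gamma>_def scaleR_conv_of_real complex_norm_square del: of_real_power of_real_power_int)
  then show ?thesis
    by (simp only: of_real_eq_iff)
qed

lemma wavelet_transform_lattice_l2:
  assumes "q_wavelet q \<alpha> g"
  shows "coeffs g \<in> l2" "(\<lambda>i. q_fourier q \<alpha> g (q powi i)) \<in> l2"
    "wavelet_const q \<alpha> g = (1 - q) * l2_sq (\<lambda>i. q_fourier q \<alpha> g (q powi i))"
    "0 < wavelet_const q \<alpha> g"
proof -
  have e: "q powi n *\<^sub>R (z / q powi n) = z" for n and z :: real
    using q by simp
  show "coeffs g \<in> l2" "(\<lambda>i. q_fourier q \<alpha> g (q powi i)) \<in> l2"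
    "wavelet_const q \<alpha> g = (1 - q) * l2_sq (\<lambda>i. q_fourier q \<alpha> g (q powi i))"
    "0 < wavelet_const q \<alpha> g"
    using assms unfolding q_wavelet_def q_L2_iff q_integrable_def wavelet_const_def q_integral_def e
    by (simp_all add: l2_def l2_sq_def)
qed

lemma q_inner_lattice:
  assumes "f1 \<in> q_L2 q \<alpha>" "f2 \<in> q_L2 q \<alpha>"
  shows "q_integrable q (\<lambda>x. f1 x * cnj (f2 x) * of_real (x powr (2 * \<alpha> + 1)))"
    and "q_integral q (\<lambda>x. f1 x * cnj (f2 x) * of_real (x powr (2 * \<alpha> + 1)))
         = (1 - q) *\<^sub>R l2_inner (coeffs f1) (coeffs f2)"
proof -
  have e: "q powi n *\<^sub>R (f1 (q powi n) * cnj (f2 (q powi n)) * of_real ((q powi n) powr (2 * \<alpha> + 1)))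
      = coeffs f1 n * cnj (coeffs f2 n)" for n
    unfolding lattice_weight_complex by (simp add: coeffs_def power2_eq_square)
  show "q_integrable q (\<lambda>x. f1 x * cnj (f2 x) * of_real (x powr (2 * \<alpha> + 1)))"
    unfolding q_integrable_def e
    using assms by (intro has_sum_imp_summable[OF l2_inner_has_sum]) (auto simp: q_L2_iff)
  show "q_integral q (\<lambda>x. f1 x * cnj (f2 x) * of_real (x powr (2 * \<alpha> + 1)))
         = (1 - q) *\<^sub>R l2_inner (coeffs f1) (coeffs f2)"
    unfolding q_integral_def e l2_inner_def ..
qed

lemma wavelet_Plancherel:
  assumes g: "q_wavelet q \<alpha> g" and f: "f \<in> q_L2 q \<alpha>"
  defines "h \<equiv> \<lambda>a b. (cmod (wavelet_transform q \<alpha> g f a b))\<^sup>2 * b powr (2 * \<alpha> + 1) / a\<^sup>2"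
  shows "q_integrable2 q h"
    and "1 / wavelet_const q \<alpha> g * q_integral q (\<lambda>a. q_integral q (h a)) = (q_L2_norm q \<alpha> f)\<^sup>2"
proof -
  define \<gamma> where "\<gamma> i = q_fourier q \<alpha> g (q powi i)" for i
  have \<gamma>: "\<gamma> \<in> l2" and C: "wavelet_const q \<alpha> g = (1 - q) * l2_sq \<gamma>" "0 < wavelet_const q \<alpha> g"
    and g': "coeffs g \<in> l2"
    using wavelet_transform_lattice_l2[OF g] by (simp_all add: \<gamma>_def[abs_def])
  have f': "coeffs f \<in> l2"
    using f by (simp add: q_L2_iff)
  have h: "(q powi j * q powi n) *\<^sub>R h (q powi j) (q powi n) = (cmod (band \<gamma> (coeffs f) j n))\<^sup>2" for
      j n
    unfolding h_def \<gamma>_def[abs_def] by (rule wavelet_square_lattice[OF f' g'])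
  have sm: "(\<lambda>(j, n). (cmod (band \<gamma> (coeffs f) j n))\<^sup>2) summable_on UNIV"
    by (rule band_sq_summable[OF f' \<gamma>])
  then show "q_integrable2 q h"
    unfolding q_integrable2_def h .
  have "l2_inner (coeffs f) (coeffs f) = of_real (l2_sq (coeffs f))"
    unfolding l2_inner_def by (rule infsumI[OF l2_inner_self_has_sum[OF f']])
  then have "((\<lambda>z. complex_of_real (case z of (j, n) \<Rightarrow> (cmod (band \<gamma> (coeffs f) j n))\<^sup>2))
      has_sum of_real (l2_sq (coeffs f) * l2_sq \<gamma>)) UNIV"
    using band_has_sum[OF f' f' \<gamma>] by (simp add: case_prod_unfold complex_norm_square del:
        of_real_power)
  then have "((\<lambda>(j, n). (cmod (band \<gamma> (coeffs f) j n))\<^sup>2) has_sum (l2_sq (coeffs f) * l2_sq \<gamma>)) UNIV"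
    by (subst (asm) has_sum_of_real_iff)
  then have "(\<Sum>\<^sub>\<infinity>j. \<Sum>\<^sub>\<infinity>n. (cmod (band \<gamma> (coeffs f) j n))\<^sup>2) = l2_sq (coeffs f) * l2_sq \<gamma>"
    using infsum_Sigma'_banach[of "\<lambda>j n. (cmod (band \<gamma> (coeffs f) j n))\<^sup>2" UNIV "\<lambda>_. UNIV"] sm
        infsumI by fastforce
  then have "q_integral q (\<lambda>a. q_integral q (h a)) = (1 - q)\<^sup>2 * (l2_sq (coeffs f) * l2_sq \<gamma>)"
    unfolding q_integral_iterated h by simp
  then show "1 / wavelet_const q \<alpha> g * q_integral q (\<lambda>a. q_integral q (h a)) = (q_L2_norm q \<alpha> f)\<^sup>2"
    using C q unfolding q_L2_norm_sq by (auto simp: power2_eq_square zero_less_mult_iff)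
qed

lemma wavelet_Parseval:
  assumes g: "q_wavelet q \<alpha> g" and f1: "f1 \<in> q_L2 q \<alpha>" and f2: "f2 \<in> q_L2 q \<alpha>"
  defines "h \<equiv> \<lambda>b a. wavelet_transform q \<alpha> g f1 a b * cnj (wavelet_transform q \<alpha> g f2 a b)
                 * of_real (b powr (2 * \<alpha> + 1) / a\<^sup>2)"
  shows "q_integrable2 q h"
    and "q_integral q (\<lambda>x. f1 x * cnj (f2 x) * of_real (x powr (2 * \<alpha> + 1)))
         = 1 / of_real (wavelet_const q \<alpha> g) * q_integral q (\<lambda>b. q_integral q (h b))"
proof -
  define \<gamma> where "\<gamma> i = q_fourier q \<alpha> g (q powi i)" for i
  define W where "W n j = band \<gamma> (coeffs f1) j n * cnj (band \<gamma> (coeffs f2) j n)" for n j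
  have \<gamma>: "\<gamma> \<in> l2" and C: "wavelet_const q \<alpha> g = (1 - q) * l2_sq \<gamma>" "0 < wavelet_const q \<alpha> g"
    and g': "coeffs g \<in> l2"
    using wavelet_transform_lattice_l2[OF g] by (simp_all add: \<gamma>_def[abs_def])
  have f': "coeffs f1 \<in> l2" "coeffs f2 \<in> l2"
    using f1 f2 by (simp_all add: q_L2_iff)
  have h: "(q powi n * q powi j) *\<^sub>R h (q powi n) (q powi j) = W n j" for j n
    unfolding h_def \<gamma>_def[abs_def] W_def mult.commute[of "q powi n" "q powi j"]
    by (rule wavelet_product_lattice[OF f' g'])
  have "((\<lambda>(j, n). W n j) has_sum l2_inner (coeffs f1) (coeffs f2) * l2_sq \<gamma>) (UNIV \<times> UNIV)"
    using band_has_sum[OF f' \<gamma>] by (simp add: W_def)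
  then have S: "((\<lambda>(n, j). W n j) has_sum l2_inner (coeffs f1) (coeffs f2) * l2_sq \<gamma>) (UNIV \<times> UNIV)"
    by (subst has_sum_swap) simp
  then have sm: "(\<lambda>(n, j). W n j) summable_on (UNIV \<times> UNIV)"
    by (rule has_sum_imp_summable)
  then show "q_integrable2 q h"
    unfolding q_integrable2_def h by simp
  have "(\<Sum>\<^sub>\<infinity>n. \<Sum>\<^sub>\<infinity>j. W n j) = l2_inner (coeffs f1) (coeffs f2) * l2_sq \<gamma>"
    using infsum_Sigma'_banach[OF sm] infsumI[OF S] by simp
  then have "q_integral q (\<lambda>b. q_integral q (h b))
      = (1 - q)\<^sup>2 *\<^sub>R (l2_inner (coeffs f1) (coeffs f2) * l2_sq \<gamma>)"
    unfolding q_integral_iterated h by simp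
  also have "\<dots> = of_real (wavelet_const q \<alpha> g) * ((1 - q) *\<^sub>R l2_inner (coeffs f1) (coeffs f2))"
    unfolding C(1) by (simp add: scaleR_conv_of_real power2_eq_square)
  finally show "q_integral q (\<lambda>x. f1 x * cnj (f2 x) * of_real (x powr (2 * \<alpha> + 1)))
         = 1 / of_real (wavelet_const q \<alpha> g) * q_integral q (\<lambda>b. q_integral q (h b))"
    unfolding q_inner_lattice(2)[OF f1 f2] using C(2) by simp
qed

end

theorem theorem6:
  fixes q \<alpha> :: real and g :: "real \<Rightarrow> complex"
  assumes "0 < q" and "q < 1" and "ln (1 - q) / ln q \<in> \<int>" and "\<alpha> > - 1 / 2"
    and "q_wavelet q \<alpha> g"
  shows
    "(\<forall>f\<in>q_L2 q \<alpha>.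
        q_integrable2 q (\<lambda>a b. (cmod (wavelet_transform q \<alpha> g f a b))\<^sup>2
                                 * b powr (2 * \<alpha> + 1) / a\<^sup>2) \<and>
        1 / wavelet_const q \<alpha> g *
          q_integral q (\<lambda>a. q_integral q (\<lambda>b. (cmod (wavelet_transform q \<alpha> g f a b))\<^sup>2
                                                * b powr (2 * \<alpha> + 1) / a\<^sup>2))
        = (q_L2_norm q \<alpha> f)\<^sup>2)
     \<and>
     (\<forall>f1\<in>q_L2 q \<alpha>. \<forall>f2\<in>q_L2 q \<alpha>.
        q_integrable q (\<lambda>x. f1 x * cnj (f2 x) * of_real (x powr (2 * \<alpha> + 1))) \<and>
        q_integrable2 q (\<lambda>b a. wavelet_transform q \<alpha> g f1 a b
                                 * cnj (wavelet_transform q \<alpha> g f2 a b)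
                                 * of_real (b powr (2 * \<alpha> + 1) / a\<^sup>2)) \<and>
        q_integral q (\<lambda>x. f1 x * cnj (f2 x) * of_real (x powr (2 * \<alpha> + 1)))
        = 1 / of_real (wavelet_const q \<alpha> g) *
          q_integral q (\<lambda>b. q_integral q (\<lambda>a. wavelet_transform q \<alpha> g f1 a b
                                                * cnj (wavelet_transform q \<alpha> g f2 a b)
                                                * of_real (b powr (2 * \<alpha> + 1) / a\<^sup>2))))"
proof -
  obtain s :: int where "ln (1 - q) / ln q = of_int s"
    using assms(3) by (auto elim: Ints_cases)
  then have "ln (1 - q) = of_int s * ln q"
    using assms(1,2) by (simp add: field_simps)
  then have "exp (ln (1 - q)) = q powr of_int s"
    using assms(1) by (simp add: powr_def)
  then have "1 - q = q powi s"
    using assms(1,2) by (simp add: powr_real_of_int')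
  then interpret q_bessel q \<alpha> s
    using assms by unfold_locales auto
  show ?thesis
    by (intro conjI ballI wavelet_Plancherel wavelet_Parseval q_inner_lattice assms(5))
qed

end
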